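(* Let $G$ be a connected graph of order $n\ge 6$. Then (1) $\eta_p(G)=n$ if and only if $G$ is isomorphic to the complete graph $K_n$ or to the star $K_{1,n-1}$; and (2) $\eta_p(G)=n-1$ if and only if $G$ is isomorphic to the complete split graph $K_{n-2}\vee\overline{K_2}$ or to the graph $K_1\vee(K_1+K_{n-2})$.
   Context: All graphs are finite, simple, undirected and connected. $+$ denotes disjoint union, $\vee$ denotes join (disjoint union plus all edges between the two graphs), $\overline{K_m}$ is the edgeless graph on $m$ vertices. For $v\in V(G)$ and $S\subseteq V(G)$, $d(v,S)=\min\{d(v,w):w\in S\}$. For a partition $\Pi=\{S_1,\dots,S_k\}$ of $V(G)$, let $r(u|\Pi)=(d(u,S_1),\dots,d(u,S_k))$. $\Pi$ is resolving if $r(u|\Pi)\neq r(v|\Pi)$ for all distinct $u,v$; dominating if every vertex $v$ has $d(v,S_j)=1$ for some $j$. $\eta_p(G)$ is the minimum cardinality of a partition of $V(G)$ that is both resolving and dominating. *)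

theory Defs
  imports "Graph_Theory.Graph_Theory" "HOL-Library.Disjoint_Sets"
begin

text \<open>
  Finite simple undirected graphs are the symmetric loop-free pair digraphs, i.e. the locale
  \<^locale>\<open>pair_graph\<close>; an undirected edge is a pair of opposite arcs.
\<close>

section \<open>Graph constructions\<close>

definition complete_graph :: "nat \<Rightarrow> nat pair_pre_digraph" where
  "complete_graph m = \<lparr>pverts = {..<m}, parcs = {(i, j). i < m \<and> j < m \<and> i \<noteq> j}\<rparr>"

definition empty_graph :: "nat \<Rightarrow> nat pair_pre_digraph" where
  "empty_graph m = \<lparr>pverts = {..<m}, parcs = {}\<rparr>"

definition disjoint_union_graph ::
  "'a pair_pre_digraph \<Rightarrow> 'b pair_pre_digraph \<Rightarrow> ('a + 'b) pair_pre_digraph" where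
  "disjoint_union_graph G H =
     \<lparr>pverts = pverts G <+> pverts H,
      parcs = map_prod Inl Inl ` parcs G \<union> map_prod Inr Inr ` parcs H\<rparr>"

definition join_graph ::
  "'a pair_pre_digraph \<Rightarrow> 'b pair_pre_digraph \<Rightarrow> ('a + 'b) pair_pre_digraph" where
  "join_graph G H =
     \<lparr>pverts = pverts (disjoint_union_graph G H),
      parcs = parcs (disjoint_union_graph G H)
        \<union> (Inl ` pverts G) \<times> (Inr ` pverts H) \<union> (Inr ` pverts H) \<times> (Inl ` pverts G)\<rparr>"

definition complete_bipartite_graph :: "nat \<Rightarrow> nat \<Rightarrow> (nat + nat) pair_pre_digraph" where
  "complete_bipartite_graph m k = join_graph (empty_graph m) (empty_graph k)"

definition graph_isomorphic :: "'a pair_pre_digraph \<Rightarrow> 'b pair_pre_digraph \<Rightarrow> bool" where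
  "graph_isomorphic G H \<longleftrightarrow> digraph_iso (with_proj G) (with_proj H)"

section \<open>Distance and resolving dominating partitions\<close>

definition vdist :: "'a pair_pre_digraph \<Rightarrow> 'a \<Rightarrow> 'a \<Rightarrow> ereal" where
  "vdist G u v = wf_digraph.\<mu> (with_proj G) (\<lambda>_. 1) u v"

definition set_dist :: "'a pair_pre_digraph \<Rightarrow> 'a \<Rightarrow> 'a set \<Rightarrow> ereal" where
  "set_dist G v S = Min {vdist G v w |w. w \<in> S}"

text \<open>
  A partition is an unordered set of parts, so the vector r(u|P) is indexed by the parts
  themselves; outside of P it is undefined, so that two vectors are equal iff they agree on
  every part.
\<close>

definition partition_rep :: "'a pair_pre_digraph \<Rightarrow> 'a set set \<Rightarrow> 'a \<Rightarrow> 'a set \<Rightarrow> ereal" where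
  "partition_rep G P u = (\<lambda>S\<in>P. set_dist G u S)"

definition resolving_partition :: "'a pair_pre_digraph \<Rightarrow> 'a set set \<Rightarrow> bool" where
  "resolving_partition G P \<longleftrightarrow> partition_on (pverts G) P \<and>
     (\<forall>u\<in>pverts G. \<forall>v\<in>pverts G. u \<noteq> v \<longrightarrow> partition_rep G P u \<noteq> partition_rep G P v)"

definition dominating_partition :: "'a pair_pre_digraph \<Rightarrow> 'a set set \<Rightarrow> bool" where
  "dominating_partition G P \<longleftrightarrow> partition_on (pverts G) P \<and>
     (\<forall>v\<in>pverts G. \<exists>S\<in>P. set_dist G v S = 1)"

definition eta_p :: "'a pair_pre_digraph \<Rightarrow> nat" where
  "eta_p G = (LEAST k. \<exists>P. resolving_partition G P \<and> dominating_partition G P \<and> card P = k)"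

section \<open>Basic properties\<close>

lemma pair_graph_complete_graph: "pair_graph (complete_graph m)"
proof -
  have "finite {(i, j). i < m \<and> j < m \<and> i \<noteq> j}"
    by (rule finite_subset[of _ "{..<m} \<times> {..<m}"]) auto
  then show ?thesis
    by unfold_locales (auto simp: complete_graph_def symmetric_def sym_def)
qed

lemma pair_graph_empty_graph: "pair_graph (empty_graph m)"
  by unfold_locales (auto simp: empty_graph_def symmetric_def sym_def)

lemma pair_graph_disjoint_union_graph:
  assumes "pair_graph G" "pair_graph H"
  shows "pair_graph (disjoint_union_graph G H)"
proof -
  interpret G: pair_graph G by fact
  interpret H: pair_graph H by fact
  show ?thesis
  proof unfold_locales
    show "symmetric (with_proj (disjoint_union_graph G H))"
      using G.pair_sym_arcs H.pair_sym_arcs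
      by (auto simp: symmetric_def sym_def disjoint_union_graph_def image_iff Bex_def)
    fix e assume e: "e \<in> parcs (disjoint_union_graph G H)"
    show "fst e \<in> pverts (disjoint_union_graph G H)" "snd e \<in> pverts (disjoint_union_graph G H)"
      using e by (auto simp: disjoint_union_graph_def dest: G.wellformed' H.wellformed')
    show "fst e \<noteq> snd e"
      using e by (auto simp: disjoint_union_graph_def dest: G.pair_no_loops H.pair_no_loops)
  next
    show "finite (pverts (disjoint_union_graph G H))" "finite (parcs (disjoint_union_graph G H))"
      using G.pair_finite_verts H.pair_finite_verts G.pair_finite_arcs H.pair_finite_arcs
      by (simp_all add: disjoint_union_graph_def)
  qed
qed

lemma pair_graph_join_graph:
  assumes "pair_graph G" "pair_graph H"
  shows "pair_graph (join_graph G H)"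
proof -
  interpret G: pair_graph G by fact
  interpret H: pair_graph H by fact
  interpret D: pair_graph "disjoint_union_graph G H"
    using assms by (rule pair_graph_disjoint_union_graph)
  show ?thesis
  proof unfold_locales
    show "symmetric (with_proj (join_graph G H))"
      using D.pair_sym_arcs by (auto simp: symmetric_def sym_def join_graph_def)
    fix e assume e: "e \<in> parcs (join_graph G H)"
    show "fst e \<in> pverts (join_graph G H)" "snd e \<in> pverts (join_graph G H)"
      using e D.arc_fst_in_verts[of e] D.arc_snd_in_verts[of e]
      by (auto simp: join_graph_def disjoint_union_graph_def)
    show "fst e \<noteq> snd e"
      using e D.pair_no_loops[of e] by (auto simp: join_graph_def)
  next
    show "finite (pverts (join_graph G H))" "finite (parcs (join_graph G H))"
      using G.pair_finite_verts H.pair_finite_verts D.pair_finite_verts D.pair_finite_arcs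
      by (simp_all add: join_graph_def)
  qed
qed

lemma complete_digraph_complete_graph: "complete_digraph m (with_proj (complete_graph m))"
  by (auto simp: complete_digraph_pair_def complete_graph_def)

lemma complete_bipartite_digraph_complete_bipartite_graph:
  "complete_bipartite_digraph m k (with_proj (complete_bipartite_graph m k))"
proof -
  have "pverts (complete_bipartite_graph m k) = Inl ` {..<m} \<union> Inr ` {..<k}"
    "parcs (complete_bipartite_graph m k) =
       Inl ` {..<m} \<times> Inr ` {..<k} \<union> Inr ` {..<k} \<times> Inl ` {..<m}"
    by (auto simp: complete_bipartite_graph_def join_graph_def disjoint_union_graph_def
        empty_graph_def)
  moreover have "card (Inl ` {..<m} :: (nat + nat) set) = m"
    "card (Inr ` {..<k} :: (nat + nat) set) = k"
    by (simp_all add: card_image)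
  moreover have "(Inl ` {..<m} :: (nat + nat) set) \<inter> Inr ` {..<k} = {}"
    by auto
  moreover have "finite (Inl ` {..<m} \<union> Inr ` {..<k} :: (nat + nat) set)"
    by simp
  ultimately show ?thesis
    unfolding complete_bipartite_digraph_pair_def by metis
qed

lemma graph_isomorphic_iff:
  assumes "pair_graph G" "pair_graph H"
  shows "graph_isomorphic G H \<longleftrightarrow> (\<exists>f. bij_betw f (pverts G) (pverts H) \<and>
    (\<forall>u\<in>pverts G. \<forall>v\<in>pverts G. (u, v) \<in> parcs G \<longleftrightarrow> (f u, f v) \<in> parcs H))"
    (is "?L \<longleftrightarrow> (\<exists>f. ?R f)")
proof
  interpret G: pair_graph G by fact
  assume ?L
  then obtain h where h: "G.digraph_isomorphism h" "with_proj H = app_iso h (with_proj G)"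
    unfolding graph_isomorphic_def digraph_iso_def by blast
  have tl: "iso_tail h = fst" and hd: "iso_head h = snd"
    and vs: "pverts H = iso_verts h ` pverts G" and as: "parcs H = iso_arcs h ` parcs G"
    using h(2) by (auto simp: with_proj_def app_iso_def)
  have inj: "inj_on (iso_verts h) (pverts G)"
    and ends: "\<And>a. a \<in> parcs G \<Longrightarrow> iso_arcs h a = (iso_verts h (fst a), iso_verts h (snd a))"
    using h(1) by (auto simp: G.digraph_isomorphism_def tl hd prod_eq_iff)
  have "?R (iso_verts h)"
  proof (intro conjI ballI)
    show "bij_betw (iso_verts h) (pverts G) (pverts H)"
      using inj vs by (simp add: bij_betw_def)
    fix u v assume uv: "u \<in> pverts G" "v \<in> pverts G"
    show "(u, v) \<in> parcs G \<longleftrightarrow> (iso_verts h u, iso_verts h v) \<in> parcs H"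
    proof
      assume "(u, v) \<in> parcs G"
      then show "(iso_verts h u, iso_verts h v) \<in> parcs H"
        using ends[of "(u, v)"] as by (metis fst_conv imageI snd_conv)
    next
      assume "(iso_verts h u, iso_verts h v) \<in> parcs H"
      then obtain a where a: "a \<in> parcs G" "(iso_verts h u, iso_verts h v) = iso_arcs h a"
        using as by auto
      with ends have "iso_verts h u = iso_verts h (fst a)" "iso_verts h v = iso_verts h (snd a)"
        by auto
      with a(1) uv inj have "a = (u, v)"
        by (metis G.arc_fst_in_verts G.arc_snd_in_verts inj_onD prod.collapse)
      with a(1) show "(u, v) \<in> parcs G" by simp
    qed
  qed
  then show "\<exists>f. ?R f" by (rule exI[of _ "iso_verts h"])
next
  interpret G: pair_graph G by fact
  interpret H: pair_graph H by fact
  assume "\<exists>f. ?R f"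
  then obtain f where f: "?R f" ..
  then have inj: "inj_on f (pverts G)" and im: "f ` pverts G = pverts H"
    by (auto simp: bij_betw_def)
  define h where "h = \<lparr>iso_verts = f, iso_arcs = map_prod f f, iso_head = snd, iso_tail = fst\<rparr>"
  have "inj_on (map_prod f f) (parcs G)"
    by (rule inj_on_subset[OF map_prod_inj_on[OF inj inj]]) (auto dest: G.wellformed')
  then have "G.digraph_isomorphism h"
    using inj by (auto simp: G.digraph_isomorphism_def h_def G.wf_digraph)
  moreover have "parcs H = map_prod f f ` parcs G"
  proof (intro set_eqI iffI)
    fix a assume a: "a \<in> parcs H"
    then obtain u v where uv: "u \<in> pverts G" "v \<in> pverts G" "a = (f u, f v)"
      using im H.arc_fst_in_verts[OF a] H.arc_snd_in_verts[OF a] by (metis imageE prod.collapse)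
    with a f show "a \<in> map_prod f f ` parcs G" by force
  next
    fix a assume "a \<in> map_prod f f ` parcs G"
    then show "a \<in> parcs H" using f by (auto dest: G.wellformed')
  qed
  then have "with_proj H = app_iso h (with_proj G)"
    using im by (simp add: with_proj_def app_iso_def h_def)
  ultimately show ?L unfolding graph_isomorphic_def digraph_iso_def by blast
qed

lemma vdist_eq:
  assumes "pair_graph G"
  shows "vdist G u v = (INF p\<in>{p. pre_digraph.awalk (with_proj G) u p v}. ereal (real (length p)))"
proof -
  interpret pair_graph G by fact
  have "awalk_cost (\<lambda>_. 1) p = real (length p)" for p :: "('a \<times> 'a) list"
    by (induction p) auto
  then show ?thesis by (simp add: vdist_def \<mu>_def)
qed

lemma vdist_self:
  assumes "pair_graph G" "u \<in> pverts G"
  shows "vdist G u u = 0"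
proof -
  interpret pair_graph G by fact
  have "awalk u [] u" using assms by (simp add: awalk_Nil_iff)
  then have "vdist G u u \<le> ereal (real (length ([] :: ('a \<times> 'a) list)))"
    unfolding vdist_eq[OF assms(1)] by (intro INF_lower) simp
  moreover have "0 \<le> vdist G u u"
    unfolding vdist_eq[OF assms(1)] by (intro INF_greatest) simp
  ultimately show ?thesis by (simp add: zero_ereal_def antisym)
qed

lemma vdist_ge_1:
  assumes "pair_graph G" "u \<noteq> v"
  shows "1 \<le> vdist G u v"
proof -
  interpret pair_graph G by fact
  show ?thesis unfolding vdist_eq[OF assms(1)]
  proof (rule INF_greatest)
    fix p assume "p \<in> {p. awalk u p v}"
    then have "p \<noteq> []" using assms(2) by (auto simp: awalk_Nil_iff)
    then show "1 \<le> ereal (real (length p))" by (cases p) auto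
  qed
qed

lemma vdist_eq_1_iff:
  assumes "pair_graph G"
  shows "vdist G u v = 1 \<longleftrightarrow> (u, v) \<in> parcs G"
proof
  interpret pair_graph G by fact
  assume "(u, v) \<in> parcs G"
  then have "awalk u [(u, v)] v" "u \<noteq> v"
    using pair_no_loops[of "(u, v)"] by (auto simp: awalk_def dest: wellformed')
  then have "vdist G u v \<le> ereal (real (length [(u, v)]))"
    unfolding vdist_eq[OF assms(1)] by (intro INF_lower) simp
  then show "vdist G u v = 1"
    using vdist_ge_1[OF assms(1) \<open>u \<noteq> v\<close>] by (simp add: one_ereal_def antisym)
next
  interpret pair_graph G by fact
  assume d: "vdist G u v = 1"
  have "vdist G u v < 2" by (simp add: d)
  then obtain p where p: "awalk u p v" "ereal (real (length p)) < 2"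
    unfolding vdist_eq[OF assms(1)] INF_less_iff by auto
  have "(2 :: ereal) = ereal 2" by simp
  with p(2) have "length p < 2" by (simp only: less_ereal.simps(1))
  moreover have "p \<noteq> []"
  proof
    assume "p = []"
    then have "u = v" "u \<in> pverts G" using p(1) by (auto simp: awalk_Nil_iff)
    then show False using d vdist_self[OF assms(1)] by simp
  qed
  ultimately obtain a where "p = [a]" by (cases p) auto
  then show "(u, v) \<in> parcs G" using p(1) by (cases a) (auto simp: awalk_def)
qed

lemma set_dist_singleton: "set_dist G u {v} = vdist G u v"
  by (simp add: set_dist_def)

text \<open>The minimum defining \<^const>\<open>eta_p\<close> ranges over a nonempty set.\<close>

lemma singletons_resolving_dominating:
  assumes "pair_graph G" "Digraph_Component.connected (with_proj G)" "card (pverts G) \<ge> 2"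
  defines "P \<equiv> (\<lambda>v. {v}) ` pverts G"
  shows "resolving_partition G P" "dominating_partition G P" "card P = card (pverts G)"
proof -
  interpret pair_graph G by fact
  have part: "partition_on (pverts G) P"
    by (auto simp: P_def partition_on_def disjoint_def)
  show "card P = card (pverts G)" unfolding P_def by (intro card_image inj_onI) auto
  show "resolving_partition G P" unfolding resolving_partition_def
  proof (intro conjI part ballI impI notI)
    fix u v assume uv: "u \<in> pverts G" "v \<in> pverts G" "u \<noteq> v"
      and eq: "partition_rep G P u = partition_rep G P v"
    have "{u} \<in> P" using uv by (auto simp: P_def)
    then have "vdist G u u = vdist G v u"
      using fun_cong[OF eq, of "{u}"] by (simp add: partition_rep_def set_dist_singleton)
    then show False using vdist_self[OF assms(1) uv(1)] vdist_ge_1[OF assms(1), of v u] uv by simp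
  qed
  show "dominating_partition G P" unfolding dominating_partition_def
  proof (intro conjI part ballI)
    fix v assume v: "v \<in> pverts G"
    have "\<not> pverts G \<subseteq> {v}" using assms(3) card_mono[of "{v}" "pverts G"] by auto
    then obtain w where w: "w \<in> pverts G" "w \<noteq> v" by blast
    have "strongly_connected (with_proj G)"
      using assms(2) sym_arcs by (intro symmetric_connected_imp_strongly_connected) auto
    then have "v \<rightarrow>\<^sup>*\<^bsub>with_proj G\<^esub> w" using v w by (auto simp: strongly_connected_def)
    then obtain x where "(v, x) \<in> parcs G"
      using w(2) by (cases rule: converse_reachable_cases) auto
    then have "set_dist G v {x} = 1" "{x} \<in> P"
      using vdist_eq_1_iff[OF assms(1)] by (auto simp: P_def set_dist_singleton dest: wellformed')
    then show "\<exists>S\<in>P. set_dist G v S = 1" by blast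
  qed
qed

end

(*
Both bounds only involve adjacency. A partition of the vertices with at most n - 2 parts that
resolves and dominates at the level of adjacency exists as soon as some five vertices contain
either two disjoint pairs, or a triple, that can serve as the nontrivial parts (a "pattern"): all
other parts are singletons, and enlarging the ambient connected graph destroys nothing. So it
suffices to grow a set without isolated vertices, one adjacent vertex at a time, from five
vertices to the whole graph: as long as no pattern appears, the induced subgraph stays a complete
graph, a star, a complete graph minus an edge, or a complete graph with a pendant vertex.
Conversely, twins never share a part of a resolving partition, and in a star domination keeps the
center apart from the leaves. In the last two graphs n - 2 vertices form a clique of twins; if
there were only n - 2 parts, each would contain exactly one of them, and a further vertex adjacent
to the whole clique could not be told apart from its companion.
*)
theory Submission
  imports Defs
begin

section \<open>Patterns and exceptional graphs\<close>

text \<open>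
  \<open>separated E u v x y z\<close>: the parts \<open>{x, y}\<close> and \<open>{z}\<close> suffice to dominate and to resolve the part
  \<open>{u, v}\<close>. A triple pattern is a part \<open>{u, v, w}\<close> dominated and resolved by \<open>{x}\<close> and \<open>{y}\<close>.
\<close>

definition separated :: "('a \<Rightarrow> 'a \<Rightarrow> bool) \<Rightarrow> 'a \<Rightarrow> 'a \<Rightarrow> 'a \<Rightarrow> 'a \<Rightarrow> 'a \<Rightarrow> bool" where
  "separated E u v x y z \<longleftrightarrow>
     (E u x \<or> E u y \<or> E u z) \<and> (E v x \<or> E v y \<or> E v z) \<and>
     ((E u x \<or> E u y) \<noteq> (E v x \<or> E v y) \<or> E u z \<noteq> E v z)"

definition pair_pattern :: "('a \<Rightarrow> 'a \<Rightarrow> bool) \<Rightarrow> 'a set \<Rightarrow> bool" where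
  "pair_pattern E V \<longleftrightarrow> (\<exists>u v x y z. {u, v, x, y, z} \<subseteq> V \<and> distinct [u, v, x, y, z] \<and>
     separated E u v x y z \<and> separated E x y u v z)"

definition triple_pattern :: "('a \<Rightarrow> 'a \<Rightarrow> bool) \<Rightarrow> 'a set \<Rightarrow> bool" where
  "triple_pattern E V \<longleftrightarrow> (\<exists>u v w x y. {u, v, w, x, y} \<subseteq> V \<and> distinct [u, v, w, x, y] \<and>
     E u x \<and> \<not> E u y \<and> \<not> E v x \<and> E v y \<and> E w x \<and> E w y)"

definition complete_on :: "('a \<Rightarrow> 'a \<Rightarrow> bool) \<Rightarrow> 'a set \<Rightarrow> bool" where
  "complete_on E V \<longleftrightarrow> (\<forall>u\<in>V. \<forall>v\<in>V. E u v \<longleftrightarrow> u \<noteq> v)"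

definition star_on :: "('a \<Rightarrow> 'a \<Rightarrow> bool) \<Rightarrow> 'a set \<Rightarrow> 'a \<Rightarrow> bool" where
  "star_on E V c \<longleftrightarrow> c \<in> V \<and> (\<forall>u\<in>V. \<forall>v\<in>V. E u v \<longleftrightarrow> u \<noteq> v \<and> (u = c \<or> v = c))"

text \<open>This is a complete graph minus the edge between \<open>a\<close> and \<open>b\<close>,
  in other words K_(n-2) joined to two nonadjacent vertices.\<close>

definition split_on :: "('a \<Rightarrow> 'a \<Rightarrow> bool) \<Rightarrow> 'a set \<Rightarrow> 'a \<Rightarrow> 'a \<Rightarrow> bool" where
  "split_on E V a b \<longleftrightarrow> a \<in> V \<and> b \<in> V \<and> a \<noteq> b \<and>
     (\<forall>u\<in>V. \<forall>v\<in>V. E u v \<longleftrightarrow> u \<noteq> v \<and> \<not> (u = a \<and> v = b) \<and> \<not> (u = b \<and> v = a))"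

text \<open>The two implications leave \<open>c\<close> as the only possible neighbour of
  \<open>l\<close>. The graph is K_1 joined to K_1 + K_(n-2), with \<open>c\<close> and
  \<open>l\<close> as the two single vertices.\<close>

definition pendant_on :: "('a \<Rightarrow> 'a \<Rightarrow> bool) \<Rightarrow> 'a set \<Rightarrow> 'a \<Rightarrow> 'a \<Rightarrow> bool" where
  "pendant_on E V c l \<longleftrightarrow> c \<in> V \<and> l \<in> V \<and> c \<noteq> l \<and>
     (\<forall>u\<in>V. \<forall>v\<in>V. E u v \<longleftrightarrow> u \<noteq> v \<and> (u = l \<longrightarrow> v = c) \<and> (v = l \<longrightarrow> u = c))"

definition exceptional :: "('a \<Rightarrow> 'a \<Rightarrow> bool) \<Rightarrow> 'a set \<Rightarrow> bool" where
  "exceptional E V \<longleftrightarrow> complete_on E V \<or> (\<exists>c. star_on E V c) \<or>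
     (\<exists>a b. split_on E V a b) \<or> (\<exists>c l. pendant_on E V c l)"

text \<open>
  For five vertices the claim is propositional in the ten adjacencies. Up to symmetry there are
  fifteen candidates for a pair pattern (a leftover vertex and a perfect matching of the other
  four). Triple patterns are only needed for the fifteen wheels with four spokes, and one
  candidate per wheel suffices.
\<close>

lemma five_vertices:
  assumes sym: "\<And>x y. E x y \<Longrightarrow> E y x" and irr: "\<And>x. \<not> E x x"
    and d: "distinct [a, b, c, d, e]"
    and iso: "\<forall>x\<in>{a, b, c, d, e}. \<exists>y\<in>{a, b, c, d, e}. E x y"
    and np: "\<not> pair_pattern E {a, b, c, d, e}" and nt: "\<not> triple_pattern E {a, b, c, d, e}"
  shows "exceptional E {a, b, c, d, e}"
proof (rule ccontr)
  let ?V = "{a, b, c, d, e}"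
  assume ne: "\<not> exceptional E ?V"
  \<comment> \<open>Fixing one orientation per pair leaves exactly ten propositional atoms for
    \<open>satx\<close>.\<close>
  have s: "E b a = E a b" "E c a = E a c" "E d a = E a d" "E e a = E a e" "E c b = E b c"
    "E d b = E b d" "E e b = E b e" "E d c = E c d" "E e c = E c e" "E e d = E d e"
    using sym by blast+
  \<comment> \<open>The distinguished vertices range over \<open>?V\<close> only, so that
    simplification expands each quantifier into a finite conjunction.\<close>
  have not_complete: "\<not> complete_on E ?V"
    and not_star: "\<forall>c\<in>?V. \<not> star_on E ?V c"
    and not_split: "\<forall>a\<in>?V. \<forall>b\<in>?V. \<not> split_on E ?V a b"
    and not_pendant: "\<forall>a\<in>?V. \<forall>b\<in>?V. \<not> pendant_on E ?V a b"
    using ne unfolding exceptional_def by auto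
  have neq: "a \<noteq> b" "a \<noteq> c" "a \<noteq> d" "a \<noteq> e" "b \<noteq> c" "b \<noteq> d" "b \<noteq> e" "c \<noteq> d" "c \<noteq> e" "d \<noteq> e"
    "b \<noteq> a" "c \<noteq> a" "d \<noteq> a" "e \<noteq> a" "c \<noteq> b" "d \<noteq> b" "e \<noteq> b" "d \<noteq> c" "e \<noteq> c" "e \<noteq> d"
    using d by auto
  have P: "\<not> (separated E u v x y z \<and> separated E x y u v z)"
    if "{u, v, x, y, z} \<subseteq> ?V" "distinct [u, v, x, y, z]" for u v x y z
    using np that unfolding pair_pattern_def by blast
  have T: "\<not> (E u x \<and> \<not> E u y \<and> \<not> E v x \<and> E v y \<and> E w x \<and> E w y)"
    if "{u, v, w, x, y} \<subseteq> ?V" "distinct [u, v, w, x, y]" for u v x y w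
    using nt that unfolding triple_pattern_def by blast
  note fs = ball_simps bex_simps neq simp_thms insert_iff empty_iff irr s
  note set_simps = distinct.simps list.set insert_subset empty_subsetI
  note pairs = P[of b c d e a] P[of b d c e a] P[of b e c d a] P[of a c d e b] P[of a d c e b]
    P[of a e c d b] P[of a b d e c] P[of a d b e c] P[of a e b d c] P[of a b c e d]
    P[of a c b e d] P[of a e b c d] P[of a b c d e] P[of a c b d e] P[of a d b c e]
  note triples = T[of b d a e c] T[of b c a e d] T[of b c a d e] T[of a d b e c] T[of a c b e d]
    T[of a c b d e] T[of a d c e b] T[of a b c e d] T[of a b c d e] T[of a c d e b]
    T[of a b d e c] T[of a b d c e] T[of a c e d b] T[of a b e d c] T[of a b e c d]
  show False
    using pairs[simplified fs separated_def set_simps, unfolded s]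
      triples[simplified fs set_simps, unfolded s]
      not_complete[unfolded complete_on_def, simplified fs]
      not_star[unfolded star_on_def, simplified fs]
      not_split[unfolded split_on_def, simplified fs]
      not_pendant[unfolded pendant_on_def, simplified fs]
      iso[simplified fs]
    by satx
qed

section \<open>Adding one adjacent vertex to an exceptional graph\<close>

lemma obtain_outside:
  assumes "card S < card X" "finite S"
  obtains y where "y \<in> X" "y \<notin> S"
  using assms by (metis card_mono not_le subsetI)

text \<open>Used with \<open>Q = E v\<close> on a set of interchangeable vertices: \<open>x\<close>
  satisfies \<open>Q\<close> if any element does, and \<open>z\<close> fails \<open>Q\<close> if any
  element does. Two truth values then decide between all, some and none, while \<open>y\<close> is a
  spare third vertex.\<close>

lemma obtain_ordered_triple:
  assumes "card X \<ge> 3"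
  obtains x y z where "x \<in> X" "y \<in> X" "z \<in> X" "distinct [x, y, z]"
    "Q x \<or> (\<forall>w\<in>X. \<not> Q w)" "Q z \<longrightarrow> (\<forall>w\<in>X. Q w)"
proof -
  have "X \<noteq> {}" using assms by auto
  then obtain x where x: "x \<in> X" "Q x \<or> (\<forall>w\<in>X. \<not> Q w)" by blast
  have "card {x} < card X" using assms by simp
  then obtain z' where z': "z' \<in> X" "z' \<notin> {x}" by (rule obtain_outside) auto
  obtain z where z: "z \<in> X" "z \<noteq> x" "Q z \<longrightarrow> (\<forall>w\<in>X. Q w)"
  proof (cases "\<exists>w\<in>X. w \<noteq> x \<and> \<not> Q w")
    case True
    then show ?thesis using that by blast
  next
    case False
    then show ?thesis using that z' x by blast
  qed
  have "card {x, z} \<le> 2" by (rule card_insert_le_m1) auto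
  then have "card {x, z} < card X" using assms by linarith
  then obtain y where "y \<in> X" "y \<notin> {x, z}" by (rule obtain_outside) auto
  with x z show thesis by (intro that[of x y z]) auto
qed

lemma pair_patternI:
  assumes "{u, v, x, y, z} \<subseteq> V" "distinct [u, v, x, y, z]"
    "separated E u v x y z" "separated E x y u v z"
  shows "pair_pattern E V"
  using assms unfolding pair_pattern_def by blast

lemma triple_patternI:
  assumes "{u, v, w, x, y} \<subseteq> V" "distinct [u, v, w, x, y]"
    "E u x" "\<not> E u y" "\<not> E v x" "E v y" "E w x" "E w y"
  shows "triple_pattern E V"
  using assms unfolding triple_pattern_def by blast

context
  fixes E :: "'a \<Rightarrow> 'a \<Rightarrow> bool" and W :: "'a set" and v :: 'a
  assumes sym: "E x y \<longleftrightarrow> E y x" and irr: "\<not> E x x"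
    and v: "v \<notin> W" and nb: "\<exists>w\<in>W. E v w"
begin

text \<open>If \<open>v\<close> has at most one non-neighbour or exactly one neighbour in the
  clique, the result is exceptional. Otherwise two neighbours and two non-neighbours form two mixed
  pairs; \<open>v\<close> resolves both pairs, and the clique edges between them dominate.\<close>

lemma extend_complete:
  assumes W: "complete_on E W"
  shows "pair_pattern E (insert v W) \<or> exceptional E (insert v W)"
proof -
  have e: "E u w \<longleftrightarrow> u \<noteq> w" if "u \<in> W" "w \<in> W" for u w
    using W that by (auto simp: complete_on_def)
  from nb obtain a where a: "a \<in> W" "E v a" by blast
  consider (all) "\<forall>w\<in>W. E v w"
    | (but) p where "p \<in> W" "\<not> E v p" "\<forall>w\<in>W. w \<noteq> p \<longrightarrow> E v w"
    | (one) "\<forall>w\<in>W. E v w \<longrightarrow> w = a"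
    | (two) p q b where "p \<in> W" "\<not> E v p" "q \<in> W" "\<not> E v q" "p \<noteq> q" "b \<in> W" "E v b" "b \<noteq> a"
    by metis
  then show ?thesis
  proof cases
    case all
    then have "complete_on E (insert v W)"
      using v by (auto simp: complete_on_def e irr sym[of _ v])
    then show ?thesis by (simp add: exceptional_def)
  next
    case but
    then have "split_on E (insert v W) v p"
      using v by (auto simp: split_on_def e irr sym[of _ v])
    then show ?thesis by (auto simp: exceptional_def)
  next
    case one
    then have "E v w \<longleftrightarrow> w = a" if "w \<in> W" for w
      using a that by blast
    then have "pendant_on E (insert v W) a v"
      using v a by (auto simp: pendant_on_def e irr sym[of _ v])
    then show ?thesis by (auto simp: exceptional_def)
  next
    case two
    then have "pair_pattern E (insert v W)"
      using a v
      by (intro pair_patternI[of a p b q v]) (auto simp: separated_def e sym[of _ v])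
    then show ?thesis ..
  qed
qed

text \<open>A vertex \<open>v\<close> without a neighbour among the leaves becomes a leaf, since
  \<open>nb\<close> forces the edge to \<open>c\<close>. If \<open>v\<close> sees all leaves, the
  leaf \<open>z\<close> resolves both \<open>{c, y}\<close> and \<open>{v, x}\<close>. If it sees
  some but not all, \<open>v x\<close> is the only edge between \<open>{v, y}\<close> and
  \<open>{x, z}\<close>, so each pair resolves the other, and \<open>c\<close> dominates
  \<open>y\<close> and \<open>z\<close>.\<close>

lemma extend_star:
  assumes W: "star_on E W c" and card: "card W \<ge> 5"
  shows "pair_pattern E (insert v W) \<or> exceptional E (insert v W)"
proof -
  have c: "c \<in> W"
    and e: "\<And>u w. u \<in> W \<Longrightarrow> w \<in> W \<Longrightarrow> E u w \<longleftrightarrow> u \<noteq> w \<and> (u = c \<or> w = c)"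
    using W by (auto simp: star_on_def)
  have "card (W - {c}) \<ge> 3" using card c by simp
  then obtain x y z where xyz: "x \<in> W - {c}" "y \<in> W - {c}" "z \<in> W - {c}" "distinct [x, y, z]"
    "E v x \<or> (\<forall>w\<in>W - {c}. \<not> E v w)" "E v z \<longrightarrow> (\<forall>w\<in>W - {c}. E v w)"
    by (rule obtain_ordered_triple[where Q = "E v"])
  show ?thesis
  proof (cases "E v x")
    case False
    then have "star_on E (insert v W) c"
      using xyz v c nb by (auto simp: star_on_def e irr sym[of _ v])
    then show ?thesis by (auto simp: exceptional_def)
  next
    case x: True
    show ?thesis
    proof (cases "E v z")
      case True
      then have "pair_pattern E (insert v W)"
        using x xyz v c
        by (intro pair_patternI[of c y v x z]) (auto simp: separated_def e sym[of _ v])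
      then show ?thesis ..
    next
      case False
      then have "pair_pattern E (insert v W)"
        using x xyz v c
        by (intro pair_patternI[of v y x z c]) (auto simp: separated_def e sym[of _ v])
      then show ?thesis ..
    qed
  qed
qed

text \<open>Outside \<open>a\<close> and \<open>b\<close> all old vertices are interchangeable, so
  three of them represent the rest. The shape persists if \<open>v\<close> sees everything. Two
  pairs work otherwise, except that a triple is used when \<open>v\<close> sees both
  \<open>a\<close> and \<open>b\<close> but not the whole clique.\<close>

lemma extend_split:
  assumes W: "split_on E W a b" and card: "card W \<ge> 5"
  shows "pair_pattern E (insert v W) \<or> triple_pattern E (insert v W) \<or> exceptional E (insert v W)"
proof -
  have ab: "a \<in> W" "b \<in> W" "a \<noteq> b"
    and e: "\<And>u w. u \<in> W \<Longrightarrow> w \<in> W \<Longrightarrow>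
      E u w \<longleftrightarrow> u \<noteq> w \<and> \<not> (u = a \<and> w = b) \<and> \<not> (u = b \<and> w = a)"
    using W by (auto simp: split_on_def)
  have "card (W - {a, b}) \<ge> 3" using card ab by (simp add: card_Diff_subset)
  then obtain x y z where xyz: "x \<in> W - {a, b}" "y \<in> W - {a, b}" "z \<in> W - {a, b}"
    "distinct [x, y, z]"
    "E v x \<or> (\<forall>w\<in>W - {a, b}. \<not> E v w)" "E v z \<longrightarrow> (\<forall>w\<in>W - {a, b}. E v w)"
    by (rule obtain_ordered_triple[where Q = "E v"])
  \<comment> \<open>The truth value of \<open>E v z\<close> says whether \<open>v\<close> sees the
    whole clique. If \<open>v\<close> sees none of \<open>a\<close>, \<open>b\<close>,
    \<open>z\<close>, then \<open>nb\<close> and the choice of \<open>x\<close> give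
    \<open>E v x\<close>, which is case \<open>none\<close>.\<close>
  consider (full) "E v z" "E v a" "E v b" | (tri) "E v a" "E v b" "\<not> E v z"
    | (none) "\<not> E v a" "\<not> E v b" "E v x" "\<not> E v z"
    | (a) "\<not> E v a" "E v b \<longleftrightarrow> \<not> E v z" | (b) "\<not> E v b" "E v a" "\<not> E v z"
    | (az) "\<not> E v a" "E v b" "E v z" | (bz) "\<not> E v b" "E v a" "E v z"
    using xyz nb by blast
  then show ?thesis
  proof cases
    case full
    then have "split_on E (insert v W) a b"
      using xyz ab v by (auto simp: split_on_def e irr sym[of _ v])
    then show ?thesis by (auto simp: exceptional_def)
  next
    case tri
    \<comment> \<open>With respect to \<open>a\<close> and \<open>z\<close>, the vertices
      \<open>v\<close>, \<open>b\<close>, \<open>y\<close> have the adjacency vectors (1,0), (0,1)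
      and (1,1).\<close>
    then have "triple_pattern E (insert v W)"
      using xyz(1-4) ab v
      by (intro triple_patternI[of v b y a z]) (auto simp: e sym[of _ v])
    then show ?thesis by simp
  next
    case none
    then have "pair_pattern E (insert v W)"
      using xyz(1-4) ab v
      by (intro pair_patternI[of a x v z b]) (auto simp: separated_def e sym[of _ v])
    then show ?thesis by simp
  next
    case a
    then have "pair_pattern E (insert v W)"
      using xyz(1-4) ab v
      by (intro pair_patternI[of a z v x b]) (auto simp: separated_def e sym[of _ v])
    then show ?thesis by simp
  next
    case b
    then have "pair_pattern E (insert v W)"
      using xyz(1-4) ab v
      by (intro pair_patternI[of b z v x a]) (auto simp: separated_def e sym[of _ v])
    then show ?thesis by simp
  next
    case az
    then have "pair_pattern E (insert v W)"
      using xyz(1-4) ab v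
      by (intro pair_patternI[of b x v z a]) (auto simp: separated_def e sym[of _ v])
    then show ?thesis by simp
  next
    case bz
    then have "pair_pattern E (insert v W)"
      using xyz(1-4) ab v
      by (intro pair_patternI[of a x v z b]) (auto simp: separated_def e sym[of _ v])
    then show ?thesis by simp
  qed
qed

text \<open>The shape persists if \<open>v\<close> sees \<open>c\<close> and the whole clique but
  not \<open>l\<close>. In case \<open>rest\<close> the clique vertex \<open>z\<close>, not adjacent
  to \<open>v\<close>, resolves both \<open>{c, v}\<close> and \<open>{l, x}\<close>. In cases
  \<open>c\<close> and \<open>z\<close> the edge \<open>z x\<close> is present while
  \<open>l\<close> has no neighbour in \<open>{v, x}\<close>, and the missing edges
  \<open>v l\<close> and \<open>x l\<close> leave only clique adjacencies to compare; the listed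
  pairs satisfy \<open>separated\<close> in both directions.\<close>

lemma extend_pendant:
  assumes W: "pendant_on E W c l" and card: "card W \<ge> 5"
  shows "pair_pattern E (insert v W) \<or> exceptional E (insert v W)"
proof -
  have cl: "c \<in> W" "l \<in> W" "c \<noteq> l"
    and e: "\<And>u w. u \<in> W \<Longrightarrow> w \<in> W \<Longrightarrow>
      E u w \<longleftrightarrow> u \<noteq> w \<and> (u = l \<longrightarrow> w = c) \<and> (w = l \<longrightarrow> u = c)"
    using W by (auto simp: pendant_on_def)
  have "card (W - {c, l}) \<ge> 3" using card cl by (simp add: card_Diff_subset)
  then obtain x y z where xyz: "x \<in> W - {c, l}" "y \<in> W - {c, l}" "z \<in> W - {c, l}"
    "distinct [x, y, z]"
    "E v x \<or> (\<forall>w\<in>W - {c, l}. \<not> E v w)" "E v z \<longrightarrow> (\<forall>w\<in>W - {c, l}. E v w)"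
    by (rule obtain_ordered_triple[where Q = "E v"])
  consider (full) "E v z" "E v c" "\<not> E v l" | (c) "\<not> E v x" "\<not> E v z" "E v c" "\<not> E v l"
    | (z) "E v x" "E v z" "\<not> E v c" "\<not> E v l" | (zl) "E v x" "E v z" "E v l"
    | (rest) "\<not> E v z" "E v x \<or> E v l"
    using xyz nb by blast
  then show ?thesis
  proof cases
    case full
    then have "pendant_on E (insert v W) c l"
      using xyz cl v by (auto simp: pendant_on_def e irr sym[of _ v])
    then show ?thesis by (auto simp: exceptional_def)
  next
    case zl
    then have "pair_pattern E (insert v W)"
      using xyz(1-4) cl v
      by (intro pair_patternI[of c x v y l]) (auto simp: separated_def e sym[of _ v])
    then show ?thesis by simp
  next
    case rest
    then have "pair_pattern E (insert v W)"
      using xyz(1-4) cl v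
      by (intro pair_patternI[of c v l x z]) (auto simp: separated_def e sym[of _ v])
    then show ?thesis by simp
  next
    case c
    then have "pair_pattern E (insert v W)"
      using xyz(1-4) cl v
      by (intro pair_patternI[of l z v x c]) (auto simp: separated_def e sym[of _ v])
    then show ?thesis by simp
  next
    case z
    then have "pair_pattern E (insert v W)"
      using xyz(1-4) cl v
      by (intro pair_patternI[of l z v x c]) (auto simp: separated_def e sym[of _ v])
    then show ?thesis by simp
  qed
qed

lemma extend_exceptional:
  assumes "exceptional E W" "card W \<ge> 5"
  shows "pair_pattern E (insert v W) \<or> triple_pattern E (insert v W) \<or> exceptional E (insert v W)"
proof -
  consider "complete_on E W" | c where "star_on E W c" | a b where "split_on E W a b"
    | c l where "pendant_on E W c l"
    using assms(1) unfolding exceptional_def by metis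
  then show ?thesis
  proof cases
    case 1 then show ?thesis using extend_complete by metis
  next
    case 2 then show ?thesis using extend_star assms(2) by metis
  next
    case 3 then show ?thesis using extend_split assms(2) by metis
  next
    case 4 then show ?thesis using extend_pendant assms(2) by metis
  qed
qed

end

lemma pair_pattern_mono: "pair_pattern E W \<Longrightarrow> W \<subseteq> V \<Longrightarrow> pair_pattern E V"
  unfolding pair_pattern_def by (meson subset_trans)

lemma triple_pattern_mono: "triple_pattern E W \<Longrightarrow> W \<subseteq> V \<Longrightarrow> triple_pattern E V"
  unfolding triple_pattern_def by (meson subset_trans)

abbreviation adj :: "'a pair_pre_digraph \<Rightarrow> 'a \<Rightarrow> 'a \<Rightarrow> bool" where
  "adj G u v \<equiv> (u, v) \<in> parcs G"

section \<open>Patterns in connected graphs\<close>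

text \<open>This supplies the next vertex whenever a vertex set is grown. If no edge entered
  \<open>W\<close> from outside, a path starting outside could never reach \<open>W\<close>.\<close>

lemma connected_edge_out:
  assumes "pair_graph G" "Digraph_Component.connected (with_proj G)"
    and "W \<subset> pverts G" "W \<noteq> {}"
  shows "\<exists>v\<in>pverts G - W. \<exists>w\<in>W. adj G v w"
proof (rule ccontr)
  interpret pair_graph G by fact
  assume no: "\<not> ?thesis"
  obtain w x where wx: "w \<in> W" "x \<in> pverts G" "x \<notin> W" using assms by blast
  have "strongly_connected (with_proj G)"
    using assms(2) sym_arcs by (intro symmetric_connected_imp_strongly_connected) auto
  then have "x \<rightarrow>\<^sup>*\<^bsub>with_proj G\<^esub> w" using wx assms by (auto simp: strongly_connected_def)
  then show False
    using wx(1,3)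
  proof (induction rule: converse_reachable_induct)
    case (step x y)
    have "adj G x y" using step.hyps(1) by simp
    then show ?case
      using no step by (metis Diff_iff wellformed'(1))
  qed simp
qed

lemma connected_no_isolated:
  assumes "pair_graph G" "Digraph_Component.connected (with_proj G)"
    and "card (pverts G) \<ge> 2" "v \<in> pverts G"
  shows "\<exists>w\<in>pverts G. adj G v w"
proof -
  interpret pair_graph G by fact
  have "{v} \<subset> pverts G" using assms(3,4) by (auto simp: psubset_eq dest: sym)
  then obtain u where "u \<in> pverts G" "adj G u v"
    using connected_edge_out[OF assms(1,2), of "{v}"] by blast
  then show ?thesis using arcs_symmetric by blast
qed

text \<open>An edge is enlarged by vertices that have a neighbour in the current set: the new vertex
  is not isolated, and the old ones keep their neighbours. The case of five vertices starts the
  growth below.\<close>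

lemma connected_no_isolated_subset:
  assumes "pair_graph G" "Digraph_Component.connected (with_proj G)"
    and "2 \<le> k" "k \<le> card (pverts G)"
  shows "\<exists>W\<subseteq>pverts G. card W = k \<and> (\<forall>x\<in>W. \<exists>y\<in>W. adj G x y)"
  using assms(3,4)
proof (induction k rule: dec_induct)
  case base
  then obtain x where x: "x \<in> pverts G" by fastforce
  interpret pair_graph G by fact
  obtain y where "y \<in> pverts G" "adj G x y"
    using connected_no_isolated[OF assms(1,2) base x] by blast
  then show ?case
    using x arcs_symmetric no_loops' by (intro exI[of _ "{x, y}"]) (auto simp: card_insert_if)
next
  case (step k)
  interpret pair_graph G by fact
  obtain W where W: "W \<subseteq> pverts G" "card W = k" "\<forall>x\<in>W. \<exists>y\<in>W. adj G x y"
    using step by auto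
  have "W \<subset> pverts G" "W \<noteq> {}" using W step by auto
  then obtain v w where vw: "v \<in> pverts G" "v \<notin> W" "w \<in> W" "adj G v w"
    using connected_edge_out[OF assms(1,2)] by blast
  have "finite W" using W(1) pair_finite_verts finite_subset by blast
  then show ?case
    using W vw by (intro exI[of _ "insert v W"]) auto
qed

lemma pattern_or_exceptional:
  assumes "pair_graph G" "Digraph_Component.connected (with_proj G)"
    and "card (pverts G) \<ge> 5"
  shows "pair_pattern (adj G) (pverts G) \<or> triple_pattern (adj G) (pverts G) \<or>
    exceptional (adj G) (pverts G)"
proof (rule ccontr)
  interpret pair_graph G by fact
  assume no: "\<not> ?thesis"
  have sym: "adj G x y \<longleftrightarrow> adj G y x" for x y using arcs_symmetric by blast
  have irr: "\<not> adj G x x" for x using no_loops' by blast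
  \<comment> \<open>The induction runs over the size \<open>k\<close>; at
    \<open>k = card (pverts G)\<close> the subset has to be the whole vertex set.\<close>
  have "\<exists>W\<subseteq>pverts G. card W = k \<and> exceptional (adj G) W"
    if "5 \<le> k" "k \<le> card (pverts G)" for k
    using that
  proof (induction k rule: dec_induct)
    case base
    obtain W where W: "W \<subseteq> pverts G" "card W = 5" "\<forall>x\<in>W. \<exists>y\<in>W. adj G x y"
      using connected_no_isolated_subset[OF assms(1,2), of 5] base by auto
    have "finite W" using W(2) card.infinite by fastforce
    then obtain xs where xs: "set xs = W" "distinct xs" using finite_distinct_list by blast
    then have "length xs = 5" using W(2) distinct_card by fastforce
    then obtain a b c d e where abc: "xs = [a, b, c, d, e]"
      by (auto simp: numeral_eq_Suc length_Suc_conv)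
    have W': "W = {a, b, c, d, e}" using xs(1) abc by simp
    have "exceptional (adj G) {a, b, c, d, e}"
    proof (rule five_vertices)
      show "distinct [a, b, c, d, e]" using xs(2) abc by simp
      show "\<forall>x\<in>{a, b, c, d, e}. \<exists>y\<in>{a, b, c, d, e}. adj G x y" using W(3) W' by blast
      show "\<not> pair_pattern (adj G) {a, b, c, d, e}" "\<not> triple_pattern (adj G) {a, b, c, d, e}"
        using no pair_pattern_mono[OF _ W(1)] triple_pattern_mono[OF _ W(1)] unfolding W' by auto
    qed (use sym irr in blast)+
    then show ?case using W W' by blast
  next
    case (step k)
    obtain W where W: "W \<subseteq> pverts G" "card W = k" "exceptional (adj G) W"
      using step by auto
    have "W \<subset> pverts G" "W \<noteq> {}" using W step by auto
    then obtain v where v: "v \<in> pverts G" "v \<notin> W" "\<exists>w\<in>W. adj G v w"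
      using connected_edge_out[OF assms(1,2)] by blast
    have "insert v W \<subseteq> pverts G" using v W by blast
    moreover have "exceptional (adj G) (insert v W)"
    proof -
      have "\<not> pair_pattern (adj G) (insert v W)" "\<not> triple_pattern (adj G) (insert v W)"
        using no pair_pattern_mono[OF _ calculation] triple_pattern_mono[OF _ calculation] by auto
      moreover have "card W \<ge> 5" using W(2) step(1) by simp
      ultimately show ?thesis
        using extend_exceptional[OF sym irr v(2,3) W(3)] by simp
    qed
    moreover have "finite W" using W(1) pair_finite_verts finite_subset by blast
    ultimately show ?case
      using W v by (intro exI[of _ "insert v W"]) auto
  qed
  then obtain W where "W \<subseteq> pverts G" "card W = card (pverts G)" "exceptional (adj G) W"
    using assms(3) by blast
  then show False
    using no card_subset_eq[OF pair_finite_verts] by auto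
qed

section \<open>Distances\<close>

lemma set_dist_altdef: "set_dist G u S = Min (vdist G u ` S)"
  by (simp add: set_dist_def setcompr_eq_image)

lemma vdist_nonneg:
  assumes "pair_graph G"
  shows "0 \<le> vdist G u v"
  unfolding vdist_eq[OF assms] by (intro INF_greatest) simp

lemma set_dist_member:
  assumes "pair_graph G" "S \<subseteq> pverts G" "u \<in> S"
  shows "set_dist G u S = 0"
proof -
  interpret pair_graph G by fact
  have "finite S" using assms(2) pair_finite_verts finite_subset by blast
  then show ?thesis
    unfolding set_dist_altdef using assms vdist_self[OF assms(1)]
    by (intro Min_eqI) (auto simp: vdist_nonneg image_iff intro!: bexI[of _ u])
qed

lemma set_dist_ge_1:
  assumes "pair_graph G" "S \<subseteq> pverts G" "S \<noteq> {}" "u \<notin> S"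
  shows "1 \<le> set_dist G u S"
proof -
  interpret pair_graph G by fact
  have "finite S" using assms(2) pair_finite_verts finite_subset by blast
  then show ?thesis
    unfolding set_dist_altdef using assms by (auto intro!: vdist_ge_1)
qed

text \<open>This is the passage from distances to adjacency: outside \<open>S\<close> all distances
  are at least 1, so the minimum equals 1 exactly when the value 1 is attained.\<close>

lemma set_dist_eq_1_iff:
  assumes "pair_graph G" "S \<subseteq> pverts G" "S \<noteq> {}" "u \<notin> S"
  shows "set_dist G u S = 1 \<longleftrightarrow> (\<exists>w\<in>S. adj G u w)"
proof -
  interpret pair_graph G by fact
  have fin: "finite S" using assms(2) pair_finite_verts finite_subset by blast
  have "1 \<le> vdist G u w" if "w \<in> S" for w using that assms by (auto intro!: vdist_ge_1)
  then have "set_dist G u S = 1 \<longleftrightarrow> 1 \<in> vdist G u ` S"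
    unfolding set_dist_altdef using fin assms(3) by (subst Min_eq_iff) auto
  also have "\<dots> \<longleftrightarrow> (\<exists>w\<in>S. vdist G u w = 1)" by (metis imageE imageI)
  finally show ?thesis by (simp add: vdist_eq_1_iff[OF assms(1)])
qed

section \<open>Upper bounds\<close>

lemma eta_p_le:
  assumes "resolving_partition G P" "dominating_partition G P"
  shows "eta_p G \<le> card P"
  unfolding eta_p_def using assms by (intro Least_le) blast

text \<open>Vertices in different parts are told apart by the distance 0 to the own part. Only
  vertices sharing a part remain, and for these it is enough that some other part is at distance 1
  from exactly one of them.\<close>

lemma eta_p_le_adjacency:
  assumes G: "pair_graph G" and P: "partition_on (pverts G) P"
    and dom: "\<And>S u. S \<in> P \<Longrightarrow> u \<in> S \<Longrightarrow> \<exists>w\<in>pverts G - S. adj G u w"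
    and res: "\<And>S u v. S \<in> P \<Longrightarrow> u \<in> S \<Longrightarrow> v \<in> S \<Longrightarrow> u \<noteq> v \<Longrightarrow>
      \<exists>T\<in>P - {S}. (\<exists>w\<in>T. adj G u w) \<noteq> (\<exists>w\<in>T. adj G v w)"
  shows "eta_p G \<le> card P"
proof (rule eta_p_le)
  have sub: "S \<subseteq> pverts G" "S \<noteq> {}" if "S \<in> P" for S
    using P that by (auto simp: partition_on_def)
  have disj: "u \<notin> T" if "S \<in> P" "T \<in> P" "u \<in> S" "T \<noteq> S" for S T u
    using P that by (auto simp: partition_on_def disjoint_def)
  show "dominating_partition G P"
    unfolding dominating_partition_def
  proof (intro conjI P ballI)
    fix v assume "v \<in> pverts G"
    then obtain S where S: "S \<in> P" "v \<in> S" using P by (auto simp: partition_on_def)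
    then obtain w where w: "w \<in> pverts G" "w \<notin> S" "adj G v w" using dom by blast
    then obtain T where T: "T \<in> P" "w \<in> T" using P by (auto simp: partition_on_def)
    then have "v \<notin> T" using disj S w by blast
    then have "set_dist G v T = 1" using set_dist_eq_1_iff[OF G] sub T w by blast
    then show "\<exists>T\<in>P. set_dist G v T = 1" using T by blast
  qed
  show "resolving_partition G P"
    unfolding resolving_partition_def
  proof (intro conjI P ballI impI notI)
    fix u v assume uv: "u \<in> pverts G" "v \<in> pverts G" "u \<noteq> v"
      and "partition_rep G P u = partition_rep G P v"
    then have eq: "set_dist G u T = set_dist G v T" if "T \<in> P" for T
      using that by (metis partition_rep_def restrict_apply')
    obtain S where S: "S \<in> P" "u \<in> S" using P uv by (auto simp: partition_on_def)
    show False
    proof (cases "v \<in> S")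
      case True
      from res[OF S True uv(3)] obtain T
        where T': "T \<in> P - {S}" and T'': "(\<exists>w\<in>T. adj G u w) \<noteq> (\<exists>w\<in>T. adj G v w)"
        by (rule bexE)
      then have T: "T \<in> P" "T \<noteq> S" by auto
      have "u \<notin> T" "v \<notin> T" using disj[OF S(1) T(1) _ T(2)] S(2) True by auto
      then show False
        using set_dist_eq_1_iff[OF G sub[OF T(1)], of u]
          set_dist_eq_1_iff[OF G sub[OF T(1)], of v] eq[OF T(1)] T'' by simp
    next
      case False
      then have "1 \<le> set_dist G v S" using set_dist_ge_1[OF G sub[OF S(1)]] by blast
      moreover have "set_dist G u S = 0" using set_dist_member[OF G] sub S by blast
      ultimately show False using eq[OF S(1)] by simp
    qed
  qed
qed

text \<open>Only the parts in \<open>Q\<close> have to be given; every vertex outside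
  \<open>U\<close> becomes a singleton part. A singleton needs no resolving and is dominated because
  no vertex is isolated, and \<open>{z}\<close> separates two vertices that differ in adjacency to
  \<open>z\<close>.\<close>

lemma eta_p_le_partial:
  assumes G: "pair_graph G" and conn: "Digraph_Component.connected (with_proj G)"
    and Q: "partition_on U Q" and U: "U \<subseteq> pverts G" and card: "card (pverts G) \<ge> 2"
    and dom: "\<And>S u. S \<in> Q \<Longrightarrow> u \<in> S \<Longrightarrow> \<exists>w\<in>pverts G - S. adj G u w"
    and res: "\<And>S u v. S \<in> Q \<Longrightarrow> u \<in> S \<Longrightarrow> v \<in> S \<Longrightarrow> u \<noteq> v \<Longrightarrow>
      (\<exists>T\<in>Q - {S}. (\<exists>w\<in>T. adj G u w) \<noteq> (\<exists>w\<in>T. adj G v w)) \<or>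
      (\<exists>z\<in>pverts G - U. adj G u z \<noteq> adj G v z)"
  shows "eta_p G \<le> card Q + (card (pverts G) - card U)"
proof -
  interpret pair_graph G by fact
  let ?R = "(\<lambda>v. {v}) ` (pverts G - U)"
  have finU: "finite U" using U pair_finite_verts finite_subset by blast
  have QU: "\<Union>Q = U" "disjoint Q" "{} \<notin> Q" using Q by (auto simp: partition_on_def)
  have nR: "S \<subseteq> U" if "S \<in> Q" for S using QU that by blast
  have "eta_p G \<le> card (Q \<union> ?R)"
  proof (rule eta_p_le_adjacency[OF G])
    show "partition_on (pverts G) (Q \<union> ?R)"
    proof (rule partition_onI)
      show "\<Union>(Q \<union> ?R) = pverts G" using QU U by auto
      show "disjnt p q" if "p \<in> Q \<union> ?R" "q \<in> Q \<union> ?R" "p \<noteq> q" for p q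
        using that QU nR by (auto simp: disjoint_def disjnt_def)
      show "{} \<notin> Q \<union> ?R" using QU by auto
    qed
    show "\<exists>w\<in>pverts G - S. adj G u w" if "S \<in> Q \<union> ?R" "u \<in> S" for S u
    proof (cases "S \<in> Q")
      case True
      then show ?thesis using dom that(2) by blast
    next
      case False
      then have S: "S = {u}" "u \<in> pverts G" using that by auto
      then obtain w where "w \<in> pverts G" "adj G u w"
        using connected_no_isolated[OF G conn card] by blast
      then show ?thesis using S no_loops' by blast
    qed
    show "\<exists>T\<in>Q \<union> ?R - {S}. (\<exists>w\<in>T. adj G u w) \<noteq> (\<exists>w\<in>T. adj G v w)"
      if "S \<in> Q \<union> ?R" "u \<in> S" "v \<in> S" "u \<noteq> v" for S u v
    proof -
      have S: "S \<in> Q" using that by auto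
      from res[OF this that(2-4)] show ?thesis
      proof
        assume "\<exists>z\<in>pverts G - U. adj G u z \<noteq> adj G v z"
        then obtain z where z: "z \<in> pverts G - U" "adj G u z \<noteq> adj G v z" by blast
        then have "{z} \<in> Q \<union> ?R - {S}" using nR[OF S] by auto
        then show ?thesis using z(2) by (intro bexI[of _ "{z}"]) auto
      qed blast
    qed
  qed
  also have "\<dots> \<le> card Q + card ?R" by (rule card_Un_le)
  also have "card ?R \<le> card (pverts G - U)"
    by (rule card_image_le) (use pair_finite_verts in auto)
  also have "card (pverts G - U) = card (pverts G) - card U"
    using finU U by (rule card_Diff_subset)
  finally show ?thesis by simp
qed

text \<open>Two pairs cover four vertices with two parts, giving 2 + (n - 4) parts; \<open>z\<close>
  is one of the singletons. The bound \<open>c\<close> keeps the truncated subtraction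
  exact.\<close>

lemma eta_p_le_pair_pattern:
  assumes G: "pair_graph G" and conn: "Digraph_Component.connected (with_proj G)"
    and p: "pair_pattern (adj G) (pverts G)"
  shows "eta_p G \<le> card (pverts G) - 2"
proof -
  interpret pair_graph G by fact
  obtain u v x y z where V: "{u, v, x, y, z} \<subseteq> pverts G" and d: "distinct [u, v, x, y, z]"
    and s: "separated (adj G) u v x y z" "separated (adj G) x y u v z"
    using p unfolding pair_pattern_def by blast
  have c5: "card {u, v, x, y, z} = 5" using d by simp
  have c: "card (pverts G) \<ge> 5" using card_mono[OF pair_finite_verts V] c5 by simp
  have "eta_p G \<le> card {{u, v}, {x, y}} + (card (pverts G) - card {u, v, x, y})"
  proof (rule eta_p_le_partial[OF G conn])
    show "partition_on {u, v, x, y} {{u, v}, {x, y}}"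
      using d by (auto simp: partition_on_def disjoint_def)
    show "{u, v, x, y} \<subseteq> pverts G" "card (pverts G) \<ge> 2" using V c by auto
    show "\<exists>w\<in>pverts G - S. adj G p w" if "S \<in> {{u, v}, {x, y}}" "p \<in> S" for S p
    proof -
      have "adj G p x \<or> adj G p y \<or> adj G p z" if "p = u \<or> p = v"
        using that s(1) by (auto simp: separated_def)
      moreover have "adj G p u \<or> adj G p v \<or> adj G p z" if "p = x \<or> p = y"
        using that s(2) by (auto simp: separated_def)
      moreover have "{x, y, z} \<subseteq> pverts G - {u, v}" "{u, v, z} \<subseteq> pverts G - {x, y}"
        using V d by auto
      ultimately show ?thesis using that by blast
    qed
    have uv: "{x, y} \<in> {{u, v}, {x, y}} - {{u, v}}" "{u, v} \<in> {{u, v}, {x, y}} - {{x, y}}"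
      using d by (auto simp: doubleton_eq_iff)
    have z: "z \<in> pverts G - {u, v, x, y}" using V d by auto
    show "(\<exists>T\<in>{{u, v}, {x, y}} - {S}. (\<exists>w\<in>T. adj G p w) \<noteq> (\<exists>w\<in>T. adj G q w)) \<or>
      (\<exists>z\<in>pverts G - {u, v, x, y}. adj G p z \<noteq> adj G q z)"
      if pq: "S \<in> {{u, v}, {x, y}}" "p \<in> S" "q \<in> S" "p \<noteq> q" for S p q
    proof -
      consider "S = {u, v}" "p = u \<and> q = v \<or> p = v \<and> q = u"
        | "S = {x, y}" "p = x \<and> q = y \<or> p = y \<and> q = x"
        using pq by auto
      then show ?thesis
      proof cases
        case 1
        have "((\<exists>w\<in>{x, y}. adj G p w) \<noteq> (\<exists>w\<in>{x, y}. adj G q w)) \<or> adj G p z \<noteq> adj G q z"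
          using 1(2) s(1) by (auto simp: separated_def)
        then show ?thesis using 1(1) uv(1) z by blast
      next
        case 2
        have "((\<exists>w\<in>{u, v}. adj G p w) \<noteq> (\<exists>w\<in>{u, v}. adj G q w)) \<or> adj G p z \<noteq> adj G q z"
          using 2(2) s(2) by (auto simp: separated_def)
        then show ?thesis using 2(1) uv(2) z by blast
      qed
    qed
  qed
  also have "card {{u, v}, {x, y}} = 2" using d by (auto simp: card_insert_if doubleton_eq_iff)
  also have "card {u, v, x, y} = 4" using d by simp
  finally show ?thesis using c by simp
qed

text \<open>One triple gives 1 + (n - 3) parts. The adjacency vectors to the singletons
  \<open>{x}\<close> and \<open>{y}\<close> are distinct, which resolves, and nonzero, which
  dominates.\<close>

lemma eta_p_le_triple_pattern:
  assumes G: "pair_graph G" and conn: "Digraph_Component.connected (with_proj G)"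
    and p: "triple_pattern (adj G) (pverts G)"
  shows "eta_p G \<le> card (pverts G) - 2"
proof -
  interpret pair_graph G by fact
  obtain u v w x y where V: "{u, v, w, x, y} \<subseteq> pverts G" and d: "distinct [u, v, w, x, y]"
    and s: "adj G u x" "\<not> adj G u y" "\<not> adj G v x" "adj G v y" "adj G w x" "adj G w y"
    using p unfolding triple_pattern_def by blast
  have c5: "card {u, v, w, x, y} = 5" using d by simp
  have c: "card (pverts G) \<ge> 5" using card_mono[OF pair_finite_verts V] c5 by simp
  have "eta_p G \<le> card {{u, v, w}} + (card (pverts G) - card {u, v, w})"
  proof (rule eta_p_le_partial[OF G conn])
    show "partition_on {u, v, w} {{u, v, w}}" by (auto simp: partition_on_def)
    show "{u, v, w} \<subseteq> pverts G" "card (pverts G) \<ge> 2" using V c by auto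
    show "\<exists>w\<in>pverts G - S. adj G p w" if "S \<in> {{u, v, w}}" "p \<in> S" for S p
      using that V d s by auto
    have xy: "x \<in> pverts G - {u, v, w}" "y \<in> pverts G - {u, v, w}" using V d by auto
    show "(\<exists>T\<in>{{u, v, w}} - {S}. (\<exists>w\<in>T. adj G p w) \<noteq> (\<exists>w\<in>T. adj G q w)) \<or>
      (\<exists>z\<in>pverts G - {u, v, w}. adj G p z \<noteq> adj G q z)"
      if "S \<in> {{u, v, w}}" "p \<in> S" "q \<in> S" "p \<noteq> q" for S p q
    proof -
      have "adj G p x \<noteq> adj G q x \<or> adj G p y \<noteq> adj G q y" using that s by auto
      then show ?thesis using xy by blast
    qed
  qed
  also have "card {u, v, w} = 3" using d by simp
  finally show ?thesis using c by simp
qed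

text \<open>A single nontrivial part \<open>{u, v}\<close> saves one part: \<open>x\<close> and
  \<open>y\<close> dominate its members and \<open>z\<close> resolves them. The vertices
  \<open>x\<close>, \<open>y\<close>, \<open>z\<close> may coincide, which the applications
  exploit.\<close>

lemma eta_p_le_merge_pair:
  assumes G: "pair_graph G" and conn: "Digraph_Component.connected (with_proj G)"
    and V: "{u, v, x, y, z} \<subseteq> pverts G" and d: "u \<noteq> v" "z \<notin> {u, v}" "x \<notin> {u, v}" "y \<notin> {u, v}"
    and s: "adj G u x" "adj G v y" "adj G u z \<noteq> adj G v z"
  shows "eta_p G \<le> card (pverts G) - 1"
proof -
  interpret pair_graph G by fact
  have c: "card (pverts G) \<ge> 2"
    using card_mono[OF pair_finite_verts, of "{u, v}"] V d by auto
  have "eta_p G \<le> card {{u, v}} + (card (pverts G) - card {u, v})"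
  proof (rule eta_p_le_partial[OF G conn])
    show "partition_on {u, v} {{u, v}}" by (auto simp: partition_on_def)
    show "{u, v} \<subseteq> pverts G" "card (pverts G) \<ge> 2" using V c by auto
  qed (use V d s in auto)
  also have "card {u, v} = 2" using d by simp
  finally show ?thesis using c by simp
qed

section \<open>Lower bounds\<close>

text \<open>A map preserving edges sends walks to walks of the same length.\<close>

lemma vdist_endomorphism_le:
  assumes "pair_graph G" and V: "\<And>x. x \<in> pverts G \<Longrightarrow> f x \<in> pverts G"
    and A: "\<And>x y. adj G x y \<Longrightarrow> adj G (f x) (f y)"
  shows "vdist G (f u) (f w) \<le> vdist G u w"
proof -
  interpret pair_graph G by fact
  have "awalk (f u) (map (map_prod f f) p) (f w)" if "awalk u p w" for p
    using that
  proof (induction p arbitrary: u)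
    case Nil
    then show ?case using V by (auto simp: awalk_Nil_iff)
  next
    case (Cons e p)
    then show ?case using A by (cases e) (auto simp: awalk_Cons_iff)
  qed
  then show ?thesis
    unfolding vdist_eq[OF assms(1)]
    by (intro INF_mono) (metis length_map mem_Collect_eq order_refl)
qed

section \<open>Twins and resolving partitions\<close>

text \<open>Adjacency between \<open>u\<close> and \<open>v\<close> themselves is left open, so
  clique vertices and leaves of a star are both covered.\<close>

definition twins :: "'a pair_pre_digraph \<Rightarrow> 'a \<Rightarrow> 'a \<Rightarrow> bool" where
  "twins G u v \<longleftrightarrow> (\<forall>w. w \<noteq> u \<longrightarrow> w \<noteq> v \<longrightarrow> adj G u w = adj G v w)"

text \<open>Swapping \<open>u\<close> and \<open>v\<close> preserves edges and fixes
  \<open>w\<close>; applying the walk argument to both vertices gives the two inequalities.\<close>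

lemma twins_vdist_eq:
  assumes "pair_graph G" "u \<in> pverts G" "v \<in> pverts G" "twins G u v" "w \<noteq> u" "w \<noteq> v"
  shows "vdist G u w = vdist G v w"
proof -
  interpret pair_graph G by fact
  have sym: "adj G x y \<longleftrightarrow> adj G y x" for x y using arcs_symmetric by blast
  define f where "f z = (if z = u then v else if z = v then u else z)" for z
  have V: "f x \<in> pverts G" if "x \<in> pverts G" for x using that assms(2,3) by (simp add: f_def)
  have A: "adj G (f x) (f y)" if "adj G x y" for x y
    using that assms(4) sym no_loops' unfolding f_def twins_def by (smt (verit))
  have "vdist G (f u) (f w) \<le> vdist G u w" "vdist G (f v) (f w) \<le> vdist G v w"
    using vdist_endomorphism_le[of G f, OF assms(1) V A] by auto
  then show ?thesis using assms(5,6) by (simp add: f_def split: if_splits)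
qed

text \<open>Twins in one part both have distance 0 to it, and every other part avoids both, so all
  its members are equally far from the two.\<close>

lemma twins_resolved:
  assumes G: "pair_graph G" and P: "resolving_partition G P"
    and S: "S \<in> P" "u \<in> S" "v \<in> S" and t: "twins G u v"
  shows "u = v"
proof (rule ccontr)
  assume ne: "u \<noteq> v"
  have part: "partition_on (pverts G) P" using P by (simp add: resolving_partition_def)
  have sub: "T \<subseteq> pverts G" if "T \<in> P" for T using part that by (auto simp: partition_on_def)
  have "set_dist G u T = set_dist G v T" if "T \<in> P" for T
  proof (cases "T = S")
    case True
    then show ?thesis using set_dist_member[OF G sub] S by simp
  next
    case False
    then have "u \<notin> T" "v \<notin> T"
      using part that S by (auto simp: partition_on_def disjoint_def)
    moreover have "u \<in> pverts G" "v \<in> pverts G" using S sub by blast+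
    ultimately have "vdist G u ` T = vdist G v ` T"
      using twins_vdist_eq[OF G _ _ t] by (intro image_cong refl) metis
    then show ?thesis by (simp add: set_dist_altdef)
  qed
  then have "partition_rep G P u = partition_rep G P v"
    by (auto simp: partition_rep_def intro: restrict_ext)
  then show False using P S sub ne unfolding resolving_partition_def by blast
qed

text \<open>The partition into singletons makes the set under \<open>LEAST\<close> nonempty.\<close>

lemma eta_p_attained:
  assumes "pair_graph G" "Digraph_Component.connected (with_proj G)" "card (pverts G) \<ge> 2"
  obtains P where "resolving_partition G P" "dominating_partition G P" "card P = eta_p G"
proof -
  have "\<exists>P. resolving_partition G P \<and> dominating_partition G P \<and> card P = card (pverts G)"
    using singletons_resolving_dominating[OF assms] by blast
  then have "\<exists>P. resolving_partition G P \<and> dominating_partition G P \<and> card P = eta_p G"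
    unfolding eta_p_def by (rule LeastI)
  then show thesis using that by blast
qed

lemma eta_p_eq_card:
  assumes G: "pair_graph G" and conn: "Digraph_Component.connected (with_proj G)"
    and card: "card (pverts G) \<ge> 2"
    and all: "\<And>P S u v. resolving_partition G P \<Longrightarrow> dominating_partition G P \<Longrightarrow>
      S \<in> P \<Longrightarrow> u \<in> S \<Longrightarrow> v \<in> S \<Longrightarrow> u = v"
  shows "eta_p G = card (pverts G)"
proof -
  obtain P where P: "resolving_partition G P" "dominating_partition G P" "card P = eta_p G"
    using eta_p_attained[OF G conn card] .
  have part: "partition_on (pverts G) P" using P by (simp add: resolving_partition_def)
  have "P = (\<lambda>v. {v}) ` pverts G"
  proof (intro set_eqI iffI)
    fix S assume "S \<in> P"
    then have "S \<noteq> {}" using part by (auto simp: partition_on_def)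
    then obtain u where u: "u \<in> S" by blast
    then have "S = {u}" using all[OF P(1,2) \<open>S \<in> P\<close>] by blast
    moreover have "u \<in> pverts G" using part \<open>S \<in> P\<close> u by (auto simp: partition_on_def)
    ultimately show "S \<in> (\<lambda>v. {v}) ` pverts G" by blast
  next
    fix S assume "S \<in> (\<lambda>v. {v}) ` pverts G"
    then obtain u where u: "S = {u}" "u \<in> pverts G" by blast
    then obtain T where "T \<in> P" "u \<in> T" using part by (auto simp: partition_on_def)
    moreover then have "T = {u}" using all[OF P(1,2)] by blast
    ultimately show "S \<in> P" using u by simp
  qed
  then have "card P = card (pverts G)" using singletons_resolving_dominating(3)[OF G conn card] by simp
  then show ?thesis using P(3) by simp
qed

lemma eta_p_complete:
  assumes G: "pair_graph G" and conn: "Digraph_Component.connected (with_proj G)"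
    and card: "card (pverts G) \<ge> 2" and K: "complete_on (adj G) (pverts G)"
  shows "eta_p G = card (pverts G)"
proof (rule eta_p_eq_card[OF G conn card])
  interpret pair_graph G by fact
  fix P S u v assume P: "resolving_partition G P" and S: "S \<in> P" "u \<in> S" "v \<in> S"
  have "S \<subseteq> pverts G" using P S by (auto simp: resolving_partition_def partition_on_def)
  then have "twins G u v"
    using K S unfolding twins_def complete_on_def by (metis subsetD wellformed'(2))
  then show "u = v" using twins_resolved[OF G P] S by blast
qed

lemma eta_p_star:
  assumes G: "pair_graph G" and conn: "Digraph_Component.connected (with_proj G)"
    and card: "card (pverts G) \<ge> 2" and K: "star_on (adj G) (pverts G) c"
  shows "eta_p G = card (pverts G)"
proof (rule eta_p_eq_card[OF G conn card])
  interpret pair_graph G by fact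
  fix P S u v
  assume P: "resolving_partition G P" "dominating_partition G P"
    and S: "S \<in> P" "u \<in> S" "v \<in> S"
  have part: "partition_on (pverts G) P" using P by (simp add: resolving_partition_def)
  then have sub: "T \<subseteq> pverts G" "T \<noteq> {}" if "T \<in> P" for T
    using that by (auto simp: partition_on_def)
  \<comment> \<open>A leaf \<open>w\<close> in the part of \<open>c\<close> would have to be
    dominated by a different part \<open>T\<close>. Its only neighbour is \<open>c\<close>, so
    \<open>c\<close> would lie in \<open>T\<close> as well as in \<open>S\<close>.\<close>
  have leaf: "w = c" if "c \<in> S" "w \<in> S" for w
  proof (rule ccontr)
    assume "w \<noteq> c"
    have "w \<in> pverts G" using that S sub by blast
    then obtain T where T: "T \<in> P" "set_dist G w T = 1"
      using P(2) by (auto simp: dominating_partition_def)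
    have "w \<notin> T"
    proof
      assume "w \<in> T"
      then have "set_dist G w T = 0" by (rule set_dist_member[OF G sub(1)[OF T(1)]])
      then show False using T(2) by simp
    qed
    then obtain x where "x \<in> T" "adj G w x" using set_dist_eq_1_iff[OF G sub[OF T(1)]] T by blast
    then have "c \<in> T"
      using K \<open>w \<noteq> c\<close> wellformed' unfolding star_on_def by (metis fst_conv snd_conv)
    then show False
      using part S T that \<open>w \<notin> T\<close> by (auto simp: partition_on_def disjoint_def)
  qed
  show "u = v"
  proof (cases "c \<in> S")
    case True
    then show ?thesis using leaf S by metis
  next
    case False
    then have "u \<noteq> c" "v \<noteq> c" "u \<in> pverts G" "v \<in> pverts G" using S sub by auto
    then have "twins G u v"
      using K unfolding twins_def star_on_def by (metis wellformed'(2))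
    then show ?thesis using twins_resolved[OF G P(1)] S by blast
  qed
qed

text \<open>A pigeonhole argument: with at most \<open>card X\<close> parts, the twins in
  \<open>X\<close> occupy all parts, one in each. The part of \<open>c\<close> then contains some
  \<open>x\<close> in \<open>X\<close>, and no part distinguishes \<open>c\<close> from
  \<open>x\<close>.\<close>

lemma eta_p_ge_twin_clique:
  assumes G: "pair_graph G" and conn: "Digraph_Component.connected (with_proj G)"
    and card: "card (pverts G) \<ge> 2"
    and X: "X \<subseteq> pverts G" "complete_on (adj G) X"
    and tw: "\<And>u v. u \<in> X \<Longrightarrow> v \<in> X \<Longrightarrow> twins G u v"
    and c: "c \<in> pverts G" "c \<notin> X" "\<And>x. x \<in> X \<Longrightarrow> adj G c x"
  shows "eta_p G > card X"
proof (rule ccontr)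
  interpret pair_graph G by fact
  assume small: "\<not> ?thesis"
  obtain P where P: "resolving_partition G P" "dominating_partition G P" "card P = eta_p G"
    using eta_p_attained[OF G conn card] .
  have part: "partition_on (pverts G) P" using P by (simp add: resolving_partition_def)
  then have sub: "T \<subseteq> pverts G" "T \<noteq> {}" if "T \<in> P" for T
    using that by (auto simp: partition_on_def)
  have "\<exists>S\<in>P. x \<in> S" if "x \<in> pverts G" for x using part that by (auto simp: partition_on_def)
  then obtain p where p: "p x \<in> P" "x \<in> p x" if "x \<in> pverts G" for x by metis
  have "inj_on p X"
    using twins_resolved[OF G P(1)] tw p X(1) by (intro inj_onI) (metis subsetD)
  then have "card (p ` X) = card X" by (rule card_image)
  moreover have "finite P" using finite_elements[OF pair_finite_verts part] .
  moreover have "p ` X \<subseteq> P" using p X(1) by blast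
  ultimately have "p ` X = P" using small P(3) by (intro card_seteq) auto
  then have meets: "\<exists>x\<in>X. x \<in> T" if "T \<in> P" for T using that p X(1) by blast
  obtain x where x: "x \<in> X" "x \<in> p c" using meets p c by blast
  \<comment> \<open>Any other part \<open>T\<close> contains a clique member \<open>y\<close>. It is
    adjacent to \<open>c\<close> by assumption and to \<open>x\<close> because \<open>x\<close> lies
    outside \<open>T\<close> and hence differs from \<open>y\<close>.\<close>
  have one: "set_dist G u T = 1" if "u \<in> {c, x}" "T \<in> P" "T \<noteq> p c" for u T
  proof -
    obtain y where y: "y \<in> X" "y \<in> T" using meets \<open>T \<in> P\<close> by blast
    have "u \<in> p c" using that p c x by blast
    then have "u \<notin> T"
      using part that(2,3) p(1)[OF c(1)] unfolding partition_on_def disjoint_def by blast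
    moreover have "adj G u y"
      using c x y X(2) that \<open>u \<notin> T\<close> by (auto simp: complete_on_def)
    ultimately show ?thesis using set_dist_eq_1_iff[OF G sub] that y by blast
  qed
  have "set_dist G c T = set_dist G x T" if "T \<in> P" for T
  proof (cases "T = p c")
    case True
    then show ?thesis using set_dist_member[OF G sub(1)] that x p c by simp
  next
    case False
    then show ?thesis using one that by simp
  qed
  then have "partition_rep G P c = partition_rep G P x"
    by (auto simp: partition_rep_def intro: restrict_ext)
  then show False using P(1) c x X(1) unfolding resolving_partition_def by (metis subsetD)
qed

lemma eta_p_split:
  assumes G: "pair_graph G" and conn: "Digraph_Component.connected (with_proj G)"
    and card: "card (pverts G) \<ge> 4" and K: "split_on (adj G) (pverts G) a b"
  shows "eta_p G = card (pverts G) - 1"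
proof -
  interpret pair_graph G by fact
  let ?X = "pverts G - {a, b}"
  have ab: "a \<in> pverts G" "b \<in> pverts G" "a \<noteq> b"
    and e: "\<And>u w. u \<in> pverts G \<Longrightarrow> w \<in> pverts G \<Longrightarrow>
      adj G u w \<longleftrightarrow> u \<noteq> w \<and> \<not> (u = a \<and> w = b) \<and> \<not> (u = b \<and> w = a)"
    using K by (auto simp: split_on_def)
  have X: "card ?X = card (pverts G) - 2" using ab pair_finite_verts by (simp add: card_Diff_subset)
  have "eta_p G > card ?X"
  proof (rule eta_p_ge_twin_clique[OF G conn, of _ a])
    show "complete_on (adj G) ?X" using e by (auto simp: complete_on_def)
    show "twins G u v" if "u \<in> ?X" "v \<in> ?X" for u v
      using that e unfolding twins_def by (metis Diff_iff insertCI wellformed'(2))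
  qed (use ab e card in auto)
  moreover have "eta_p G \<le> card (pverts G) - 1"
  proof -
    have "card {a, b} < card (pverts G)" using card ab by simp
    then obtain x where x: "x \<in> pverts G" "x \<notin> {a, b}" by (rule obtain_outside) auto
    have "card {a, b, x} < card (pverts G)" using card by (simp add: card_insert_if)
    then obtain y where y: "y \<in> pverts G" "y \<notin> {a, b, x}" by (rule obtain_outside) auto
    \<comment> \<open>The merged part is \<open>{a, x}\<close>: \<open>y\<close> is adjacent to both
      vertices, and \<open>b\<close> only to \<open>x\<close>.\<close>
    show ?thesis
      by (rule eta_p_le_merge_pair[OF G conn, of a x y y b]) (use ab x y e in auto)
  qed
  ultimately show ?thesis using X by linarith
qed

lemma eta_p_pendant:
  assumes G: "pair_graph G" and conn: "Digraph_Component.connected (with_proj G)"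
    and card: "card (pverts G) \<ge> 4" and K: "pendant_on (adj G) (pverts G) c l"
  shows "eta_p G = card (pverts G) - 1"
proof -
  interpret pair_graph G by fact
  let ?X = "pverts G - {c, l}"
  have cl: "c \<in> pverts G" "l \<in> pverts G" "c \<noteq> l"
    and e: "\<And>u w. u \<in> pverts G \<Longrightarrow> w \<in> pverts G \<Longrightarrow>
      adj G u w \<longleftrightarrow> u \<noteq> w \<and> (u = l \<longrightarrow> w = c) \<and> (w = l \<longrightarrow> u = c)"
    using K by (auto simp: pendant_on_def)
  have X: "card ?X = card (pverts G) - 2" using cl pair_finite_verts by (simp add: card_Diff_subset)
  have "eta_p G > card ?X"
  proof (rule eta_p_ge_twin_clique[OF G conn, of _ c])
    show "complete_on (adj G) ?X" using e by (auto simp: complete_on_def)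
    show "twins G u v" if "u \<in> ?X" "v \<in> ?X" for u v
      using that e unfolding twins_def by (metis Diff_iff insertCI wellformed'(2))
  qed (use cl e card in auto)
  moreover have "eta_p G \<le> card (pverts G) - 1"
  proof -
    have "card {c, l} < card (pverts G)" using card cl by simp
    then obtain x where x: "x \<in> pverts G" "x \<notin> {c, l}" by (rule obtain_outside) auto
    have "card {c, l, x} < card (pverts G)" using card by (simp add: card_insert_if)
    then obtain y where y: "y \<in> pverts G" "y \<notin> {c, l, x}" by (rule obtain_outside) auto
    \<comment> \<open>The merged part is \<open>{l, x}\<close>: \<open>c\<close> dominates
      \<open>l\<close>, while \<open>y\<close> dominates \<open>x\<close> and, not being adjacent to
      \<open>l\<close>, also resolves the part.\<close>
    show ?thesis
      by (rule eta_p_le_merge_pair[OF G conn, of l x c y y]) (use cl x y e in auto)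
  qed
  ultimately show ?thesis using X by linarith
qed

section \<open>Isomorphism types\<close>

text \<open>Stated for a relation and a vertex set, so that it applies to blocks of \<open>V\<close>
  without forming induced subgraphs.\<close>

definition iso_on :: "('a \<Rightarrow> 'a \<Rightarrow> bool) \<Rightarrow> 'a set \<Rightarrow> ('b \<Rightarrow> 'b \<Rightarrow> bool) \<Rightarrow> 'b set \<Rightarrow> bool" where
  "iso_on E V F U \<longleftrightarrow>
     (\<exists>f. bij_betw f V U \<and> (\<forall>u\<in>V. \<forall>v\<in>V. E u v \<longleftrightarrow> F (f u) (f v)))"

lemma graph_isomorphic_iff_iso_on:
  assumes "pair_graph G" "pair_graph H"
  shows "graph_isomorphic G H \<longleftrightarrow> iso_on (adj G) (pverts G) (adj H) (pverts H)"
  using graph_isomorphic_iff[OF assms] by (simp add: iso_on_def)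

text \<open>The constant \<open>k\<close> is the truth value of all adjacencies across the sum:
  \<open>True\<close> for a join, \<open>False\<close> for a disjoint union. The blocks
  \<open>A\<close> and \<open>B\<close> are the preimages of the summands, and isomorphisms on the
  blocks glue to one on \<open>V\<close>.\<close>

lemma iso_on_Plus_iff:
  assumes LL: "\<And>a b. F (Inl a) (Inl b) = F1 a b" and RR: "\<And>a b. F (Inr a) (Inr b) = F2 a b"
    and LR: "\<And>a b. a \<in> U1 \<Longrightarrow> b \<in> U2 \<Longrightarrow> F (Inl a) (Inr b) = k"
    and RL: "\<And>a b. a \<in> U1 \<Longrightarrow> b \<in> U2 \<Longrightarrow> F (Inr b) (Inl a) = k"
  shows "iso_on E V F (U1 <+> U2) \<longleftrightarrow>
    (\<exists>A B. A \<union> B = V \<and> A \<inter> B = {} \<and> iso_on E A F1 U1 \<and> iso_on E B F2 U2 \<and>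
      (\<forall>a\<in>A. \<forall>b\<in>B. E a b = k \<and> E b a = k))" (is "?L \<longleftrightarrow> ?R")
proof
  assume ?L
  then obtain f where f: "bij_betw f V (U1 <+> U2)"
    and e: "\<forall>u\<in>V. \<forall>v\<in>V. E u v \<longleftrightarrow> F (f u) (f v)"
    unfolding iso_on_def by blast
  define A where "A = {v \<in> V. f v \<in> Inl ` U1}"
  define B where "B = {v \<in> V. f v \<in> Inr ` U2}"
  have inj: "inj_on f V" and im: "f ` V = U1 <+> U2" using f by (auto simp: bij_betw_def)
  have fA: "f a = Inl (projl (f a))" "projl (f a) \<in> U1" if "a \<in> A" for a
    using that by (auto simp: A_def)
  have fB: "f b = Inr (projr (f b))" "projr (f b) \<in> U2" if "b \<in> B" for b
    using that by (auto simp: B_def)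
  have "\<exists>a\<in>A. f a = Inl x" if "x \<in> U1" for x
  proof -
    have "Inl x \<in> f ` V" using im that by blast
    then show ?thesis using that by (force simp: A_def)
  qed
  then have sA: "U1 \<subseteq> (projl \<circ> f) ` A" by (force simp: image_iff)
  have "\<exists>b\<in>B. f b = Inr x" if "x \<in> U2" for x
  proof -
    have "Inr x \<in> f ` V" using im that by blast
    then show ?thesis using that by (force simp: B_def)
  qed
  then have sB: "U2 \<subseteq> (projr \<circ> f) ` B" by (force simp: image_iff)
  have "iso_on E A F1 U1"
    unfolding iso_on_def
  proof (intro exI[of _ "projl \<circ> f"] conjI ballI)
    have "inj_on (projl \<circ> f) A"
    proof (rule inj_onI)
      fix a b assume ab: "a \<in> A" "b \<in> A" "(projl \<circ> f) a = (projl \<circ> f) b"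
      then have "f a = f b" using fA(1)[OF ab(1)] fA(1)[OF ab(2)] by simp
      then show "a = b" using inj ab by (auto simp: A_def dest: inj_onD)
    qed
    then show "bij_betw (projl \<circ> f) A U1" using sA fA(2) by (auto simp: bij_betw_def)
    show "E a b \<longleftrightarrow> F1 ((projl \<circ> f) a) ((projl \<circ> f) b)" if "a \<in> A" "b \<in> A" for a b
      using that e fA(1)[OF that(1)] fA(1)[OF that(2)] LL by (metis (no_types, lifting) A_def comp_apply mem_Collect_eq)
  qed
  moreover have "iso_on E B F2 U2"
    unfolding iso_on_def
  proof (intro exI[of _ "projr \<circ> f"] conjI ballI)
    have "inj_on (projr \<circ> f) B"
    proof (rule inj_onI)
      fix a b assume ab: "a \<in> B" "b \<in> B" "(projr \<circ> f) a = (projr \<circ> f) b"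
      then have "f a = f b" using fB(1)[OF ab(1)] fB(1)[OF ab(2)] by simp
      then show "a = b" using inj ab by (auto simp: B_def dest: inj_onD)
    qed
    then show "bij_betw (projr \<circ> f) B U2" using sB fB(2) by (auto simp: bij_betw_def)
    show "E a b \<longleftrightarrow> F2 ((projr \<circ> f) a) ((projr \<circ> f) b)" if "a \<in> B" "b \<in> B" for a b
      using that e fB(1)[OF that(1)] fB(1)[OF that(2)] RR by (metis (no_types, lifting) B_def comp_apply mem_Collect_eq)
  qed
  moreover have "A \<union> B = V" using im by (auto simp: A_def B_def Plus_def)
  moreover have "A \<inter> B = {}" by (auto simp: A_def B_def)
  moreover have "E a b = k \<and> E b a = k" if "a \<in> A" "b \<in> B" for a b
    using that e LR RL fA[OF that(1)] fB[OF that(2)] \<open>A \<union> B = V\<close> by (metis UnI1 UnI2)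
  ultimately show ?R by blast
next
  assume ?R
  then obtain A B f g where AB: "A \<union> B = V" "A \<inter> B = {}"
    and f: "bij_betw f A U1" "\<forall>u\<in>A. \<forall>v\<in>A. E u v \<longleftrightarrow> F1 (f u) (f v)"
    and g: "bij_betw g B U2" "\<forall>u\<in>B. \<forall>v\<in>B. E u v \<longleftrightarrow> F2 (g u) (g v)"
    and k: "\<forall>a\<in>A. \<forall>b\<in>B. E a b = k \<and> E b a = k"
    unfolding iso_on_def by blast
  define h where "h v = (if v \<in> A then Inl (f v) else Inr (g v))" for v
  have hA: "h a = Inl (f a)" "f a \<in> U1" if "a \<in> A" for a
    using that f(1) by (auto simp: h_def bij_betw_def)
  have hB: "h b = Inr (g b)" "g b \<in> U2" if "b \<in> B" for b
    using that AB g(1) by (auto simp: h_def bij_betw_def)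
  have "bij_betw h (A \<union> B) (Inl ` U1 \<union> Inr ` U2)"
  proof (rule bij_betw_combine)
    have "bij_betw (Inl \<circ> f) A (Inl ` U1)"
      using f(1) by (rule bij_betw_trans) (simp add: bij_betw_def)
    then show "bij_betw h A (Inl ` U1)" using hA(1) by (simp cong: bij_betw_cong)
    have "bij_betw (Inr \<circ> g) B (Inr ` U2)"
      using g(1) by (rule bij_betw_trans) (simp add: bij_betw_def)
    then show "bij_betw h B (Inr ` U2)" using hB(1) by (simp cong: bij_betw_cong)
  qed auto
  then have "bij_betw h V (U1 <+> U2)" using AB by (simp add: Plus_def)
  moreover have "E u v \<longleftrightarrow> F (h u) (h v)" if uv: "u \<in> V" "v \<in> V" for u v
  proof -
    consider "u \<in> A" "v \<in> A" | "u \<in> A" "v \<in> B" | "u \<in> B" "v \<in> A" | "u \<in> B" "v \<in> B"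
      using uv AB by blast
    then show ?thesis
    proof cases
      case 1 then show ?thesis using f(2) hA LL by simp
    next
      case 2 then show ?thesis using k hA hB LR by simp
    next
      case 3 then show ?thesis using k hA hB RL by simp
    next
      case 4 then show ?thesis using g(2) hB RR by simp
    qed
  qed
  ultimately show ?L unfolding iso_on_def by blast
qed

lemma iso_on_join_iff:
  "iso_on E V (adj (join_graph G H)) (pverts (join_graph G H)) \<longleftrightarrow>
    (\<exists>A B. A \<union> B = V \<and> A \<inter> B = {} \<and>
      iso_on E A (adj G) (pverts G) \<and> iso_on E B (adj H) (pverts H) \<and>
      (\<forall>a\<in>A. \<forall>b\<in>B. E a b \<and> E b a))"
proof -
  have V: "pverts (join_graph G H) = pverts G <+> pverts H"
    by (simp add: join_graph_def disjoint_union_graph_def)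
  show ?thesis
    unfolding V
    by (subst iso_on_Plus_iff[where k = True and ?F1.0 = "adj G" and ?F2.0 = "adj H"])
      (auto simp: join_graph_def disjoint_union_graph_def)
qed

lemma iso_on_disjoint_union_iff:
  "iso_on E V (adj (disjoint_union_graph G H)) (pverts (disjoint_union_graph G H)) \<longleftrightarrow>
    (\<exists>A B. A \<union> B = V \<and> A \<inter> B = {} \<and>
      iso_on E A (adj G) (pverts G) \<and> iso_on E B (adj H) (pverts H) \<and>
      (\<forall>a\<in>A. \<forall>b\<in>B. \<not> E a b \<and> \<not> E b a))"
proof -
  have V: "pverts (disjoint_union_graph G H) = pverts G <+> pverts H"
    by (simp add: disjoint_union_graph_def)
  show ?thesis
    unfolding V
    by (subst iso_on_Plus_iff[where k = False and ?F1.0 = "adj G" and ?F2.0 = "adj H"])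
      (auto simp: disjoint_union_graph_def)
qed

lemma iso_on_complete_iff:
  "iso_on E V (adj (complete_graph m)) (pverts (complete_graph m)) \<longleftrightarrow>
    finite V \<and> card V = m \<and> complete_on E V" (is "?L \<longleftrightarrow> ?R")
proof
  assume ?L
  then obtain f where f: "bij_betw f V {..<m}"
    "\<forall>u\<in>V. \<forall>v\<in>V. E u v \<longleftrightarrow> f u < m \<and> f v < m \<and> f u \<noteq> f v"
    by (auto simp: iso_on_def complete_graph_def)
  moreover have "f u < m" if "u \<in> V" for u using f(1) that by (auto simp: bij_betw_def)
  ultimately show ?R
    using bij_betw_finite[OF f(1)] bij_betw_same_card[OF f(1)]
    by (auto simp: complete_on_def bij_betw_def inj_on_eq_iff)
next
  assume R: ?R
  then obtain f where f: "bij_betw f V {..<m}"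
    using ex_bij_betw_finite_nat[of V] by (auto simp: atLeast0LessThan)
  moreover have "f u < m" if "u \<in> V" for u using f(1) that by (auto simp: bij_betw_def)
  ultimately show ?L
    using R by (auto simp: iso_on_def complete_graph_def complete_on_def bij_betw_def
      inj_on_eq_iff intro!: exI[of _ f])
qed

lemma iso_on_empty_iff:
  "iso_on E V (adj (empty_graph m)) (pverts (empty_graph m)) \<longleftrightarrow>
    finite V \<and> card V = m \<and> (\<forall>u\<in>V. \<forall>v\<in>V. \<not> E u v)" (is "?L \<longleftrightarrow> ?R")
proof
  assume ?L
  then obtain f where "bij_betw f V {..<m}" "\<forall>u\<in>V. \<forall>v\<in>V. \<not> E u v"
    by (auto simp: iso_on_def empty_graph_def)
  then show ?R using bij_betw_finite bij_betw_same_card by fastforce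
next
  assume R: ?R
  then obtain f where "bij_betw f V {..<m}"
    using ex_bij_betw_finite_nat[of V] by (auto simp: atLeast0LessThan)
  then show ?L using R by (auto simp: iso_on_def empty_graph_def)
qed

lemma iso_on_star_iff:
  assumes "finite V" "card V = n" "n \<ge> 1"
  defines "H \<equiv> complete_bipartite_graph 1 (n - 1)"
  shows "iso_on E V (adj H) (pverts H) \<longleftrightarrow> (\<exists>c. star_on E V c)" (is "?L \<longleftrightarrow> ?R")
proof
  assume ?L
  then obtain A B where AB: "A \<union> B = V" "A \<inter> B = {}" and A: "card A = 1"
    and ind: "\<forall>u\<in>A. \<forall>v\<in>A. \<not> E u v" "\<forall>u\<in>B. \<forall>v\<in>B. \<not> E u v"
    and cross: "\<forall>a\<in>A. \<forall>b\<in>B. E a b \<and> E b a"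
    unfolding H_def complete_bipartite_graph_def iso_on_join_iff iso_on_empty_iff by blast
  obtain c where "A = {c}" using A by (rule card_1_singletonE)
  then have "star_on E V c" using AB ind cross unfolding star_on_def by blast
  then show ?R ..
next
  assume ?R
  then obtain c where c: "star_on E V c" ..
  then have "c \<in> V" by (simp add: star_on_def)
  with c show ?L
    using assms(1-3)
    unfolding H_def complete_bipartite_graph_def iso_on_join_iff iso_on_empty_iff
    by (intro exI[of _ "{c}"] exI[of _ "V - {c}"]) (auto simp: star_on_def)
qed

lemma iso_on_split_iff:
  assumes "finite V" "card V = n" "n \<ge> 2"
  defines "H \<equiv> join_graph (complete_graph (n - 2)) (empty_graph 2)"
  shows "iso_on E V (adj H) (pverts H) \<longleftrightarrow> (\<exists>a b. split_on E V a b)" (is "?L \<longleftrightarrow> ?R")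
proof
  assume ?L
  then obtain A B where AB: "A \<union> B = V" "A \<inter> B = {}" and B: "card B = 2"
    and A: "complete_on E A" and ind: "\<forall>u\<in>B. \<forall>v\<in>B. \<not> E u v"
    and cross: "\<forall>a\<in>A. \<forall>b\<in>B. E a b \<and> E b a"
    unfolding H_def iso_on_join_iff iso_on_empty_iff iso_on_complete_iff by blast
  obtain a b where "B = {a, b}" "a \<noteq> b" using B by (auto simp: card_2_iff)
  then have "split_on E V a b"
    using AB A ind cross unfolding split_on_def complete_on_def by auto
  then show ?R by blast
next
  assume ?R
  then obtain a b where s: "split_on E V a b" by blast
  then have ab: "{a, b} \<subseteq> V" "a \<noteq> b" by (auto simp: split_on_def)
  then have "card (V - {a, b}) = n - 2" using assms(1,2) by (simp add: card_Diff_subset)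
  with s ab show ?L
    using assms(1-3)
    unfolding H_def iso_on_join_iff iso_on_empty_iff iso_on_complete_iff
    by (intro exI[of _ "V - {a, b}"] exI[of _ "{a, b}"])
      (auto simp: split_on_def complete_on_def)
qed

text \<open>The joined single vertex is \<open>c\<close>, the single vertex inside the disjoint
  union is \<open>l\<close>, and the remaining n - 2 vertices form a clique with
  \<open>c\<close>.\<close>

lemma iso_on_pendant_iff:
  assumes "finite V" "card V = n" "n \<ge> 2"
  defines "H \<equiv> join_graph (complete_graph 1)
    (disjoint_union_graph (complete_graph 1) (complete_graph (n - 2)))"
  shows "iso_on E V (adj H) (pverts H) \<longleftrightarrow> (\<exists>c l. pendant_on E V c l)" (is "?L \<longleftrightarrow> ?R")
proof
  assume ?L
  then obtain A B where AB: "A \<union> B = V" "A \<inter> B = {}" and A: "card A = 1" "complete_on E A"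
    and cross: "\<forall>a\<in>A. \<forall>b\<in>B. E a b \<and> E b a"
    and B: "iso_on E B
      (adj (disjoint_union_graph (complete_graph 1) (complete_graph (n - 2))))
      (pverts (disjoint_union_graph (complete_graph 1) (complete_graph (n - 2))))"
    unfolding H_def iso_on_join_iff iso_on_complete_iff by blast
  from B obtain C D where CD: "C \<union> D = B" "C \<inter> D = {}" and C: "card C = 1" "complete_on E C"
    and D: "complete_on E D" and no: "\<forall>a\<in>C. \<forall>b\<in>D. \<not> E a b \<and> \<not> E b a"
    unfolding iso_on_disjoint_union_iff iso_on_complete_iff by blast
  obtain c where c: "A = {c}" using A(1) by (rule card_1_singletonE)
  obtain l where l: "C = {l}" using C(1) by (rule card_1_singletonE)
  have V: "V = insert c (insert l D)" "c \<noteq> l" "c \<notin> D" "l \<notin> D" using AB CD c l by auto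
  have "pendant_on E V c l"
    using A(2) C(2) D cross no CD(1) V(2-)
    unfolding pendant_on_def complete_on_def V(1) c l by auto
  then show ?R by blast
next
  assume ?R
  then obtain c l where s: "pendant_on E V c l" by blast
  then have cl: "{c, l} \<subseteq> V" "c \<noteq> l" by (auto simp: pendant_on_def)
  then have "card (V - {c, l}) = n - 2" using assms(1,2) by (simp add: card_Diff_subset)
  with s cl have "iso_on E (V - {c})
      (adj (disjoint_union_graph (complete_graph 1) (complete_graph (n - 2))))
      (pverts (disjoint_union_graph (complete_graph 1) (complete_graph (n - 2))))"
    using assms(1)
    unfolding iso_on_disjoint_union_iff iso_on_complete_iff
    by (intro exI[of _ "{l}"] exI[of _ "V - {c, l}"])
      (auto simp: pendant_on_def complete_on_def)
  with s cl show ?L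
    using assms(1)
    unfolding H_def iso_on_join_iff iso_on_complete_iff
    by (intro exI[of _ "{c}"] exI[of _ "V - {c}"])
      (auto simp: pendant_on_def complete_on_def)
qed

theorem mainTheorem2:
  fixes G :: "'a pair_pre_digraph" and n :: nat
  assumes "pair_graph G"
    and "Digraph_Component.connected (with_proj G)"
    and "card (pverts G) = n"
    and "n \<ge> 6"
  shows "(eta_p G = n \<longleftrightarrow>
            graph_isomorphic G (complete_graph n) \<or>
            graph_isomorphic G (complete_bipartite_graph 1 (n - 1)))
       \<and> (eta_p G = n - 1 \<longleftrightarrow>
            graph_isomorphic G (join_graph (complete_graph (n - 2)) (empty_graph 2)) \<or>
            graph_isomorphic G
              (join_graph (complete_graph 1)
                 (disjoint_union_graph (complete_graph 1) (complete_graph (n - 2)))))"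
proof -
  interpret pair_graph G by fact
  let ?E = "adj G" and ?V = "pverts G"
  note G = assms(1,2)
  have fin: "finite ?V" by (rule pair_finite_verts)
  have "graph_isomorphic G (complete_graph n) \<longleftrightarrow> complete_on ?E ?V"
    using iso_on_complete_iff[of ?E ?V n] fin assms(3)
    by (simp add: graph_isomorphic_iff_iso_on assms(1) pair_graph_complete_graph)
  moreover have "graph_isomorphic G (complete_bipartite_graph 1 (n - 1)) \<longleftrightarrow>
      (\<exists>c. star_on ?E ?V c)"
    using iso_on_star_iff[OF fin assms(3), of ?E] assms(4)
    by (simp add: graph_isomorphic_iff_iso_on assms(1) complete_bipartite_graph_def
        pair_graph_join_graph pair_graph_empty_graph)
  moreover have "graph_isomorphic G (join_graph (complete_graph (n - 2)) (empty_graph 2)) \<longleftrightarrow>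
      (\<exists>a b. split_on ?E ?V a b)"
    using iso_on_split_iff[OF fin assms(3), of ?E] assms(4)
    by (simp add: graph_isomorphic_iff_iso_on assms(1) pair_graph_join_graph
        pair_graph_complete_graph pair_graph_empty_graph)
  moreover have "graph_isomorphic G (join_graph (complete_graph 1)
        (disjoint_union_graph (complete_graph 1) (complete_graph (n - 2)))) \<longleftrightarrow>
      (\<exists>c l. pendant_on ?E ?V c l)"
    using iso_on_pendant_iff[OF fin assms(3), of ?E] assms(4)
    by (simp add: graph_isomorphic_iff_iso_on assms(1) pair_graph_join_graph
        pair_graph_complete_graph pair_graph_disjoint_union_graph)
  moreover have "eta_p G = n" if "complete_on ?E ?V \<or> (\<exists>c. star_on ?E ?V c)"
    using that eta_p_complete[OF G] eta_p_star[OF G] assms(3,4) by auto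
  moreover have "eta_p G = n - 1"
    if "(\<exists>a b. split_on ?E ?V a b) \<or> (\<exists>c l. pendant_on ?E ?V c l)"
    using that eta_p_split[OF G] eta_p_pendant[OF G] assms(3,4) by auto
  moreover have "eta_p G \<le> n - 2" if "\<not> exceptional ?E ?V"
    using that pattern_or_exceptional[OF G] eta_p_le_pair_pattern[OF G]
      eta_p_le_triple_pattern[OF G] assms(3,4) by auto
  \<comment> \<open>The values n, n - 1 and at most n - 2 exclude each other, so the implications
    from graph types to values already yield both equivalences.\<close>
  moreover have "n - 2 \<noteq> n" "n - 1 \<noteq> n" "\<not> n \<le> n - 2" "\<not> n - 1 \<le> n - 2" using assms(4) by auto
  ultimately show ?thesis unfolding exceptional_def by metis
qed

end
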